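(* Let $\Gamma,\Gamma'$ be finite simplicial graphs. Then the pro-$2$ completions of the right-angled Coxeter groups $C(\Gamma)$ and $C(\Gamma')$ are isomorphic as topological groups, $\widehat{C(\Gamma)}_{(2)}\cong\widehat{C(\Gamma')}_{(2)}$, if and only if $\Gamma\cong\Gamma'$ as graphs.
   Context: A finite simplicial graph is a finite graph with no loops and no multiple edges. For a finite simplicial graph $\Gamma$ with vertex set $V(\Gamma)$, the right-angled Coxeter group $C(\Gamma)$ is the group with generating set $V(\Gamma)$, with relations $vw=wv$ for each pair of vertices $v,w$ spanning an edge of $\Gamma$, and $v^2=1$ for each vertex $v$ (and no other relations). For a discrete group $G$, the pro-$2$ completion is $\widehat{G}_{(2)}=\varprojlim_N G/N$, where $N$ ranges over the finite-index normal subgroups of $G$ such that $G/N$ is a $2$-group, with the inverse limit topology. *)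

theory Defs
  imports
    "HOL-Analysis.Function_Topology"
    "HOL-Algebra.Product_Groups"
    "Graph_Theory.Digraph_Isomorphism"
    "Graph_Theory.Pair_Digraph"
begin

text \<open>A word is a list of letters; \<open>(s, True)\<close> stands for the generator \<open>s\<close> and
  \<open>(s, False)\<close> for its formal inverse. A relation \<open>l = r\<close> is the pair \<open>(l, r)\<close>.\<close>

type_synonym 'a word = "('a \<times> bool) list"

definition words :: "'a set \<Rightarrow> 'a word set" where
  "words S = lists (S \<times> UNIV)"

text \<open>The least congruence on the monoid of words that contains the relations and makes
  \<open>(s, True)\<close> and \<open>(s, False)\<close> mutually inverse.\<close>

inductive word_eq :: "'a set \<Rightarrow> ('a word \<times> 'a word) set \<Rightarrow> 'a word \<Rightarrow> 'a word \<Rightarrow> bool"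
  for S R where
  refl: "w \<in> words S \<Longrightarrow> word_eq S R w w"
| sym: "word_eq S R u v \<Longrightarrow> word_eq S R v u"
| trans: "word_eq S R u v \<Longrightarrow> word_eq S R v w \<Longrightarrow> word_eq S R u w"
| append: "word_eq S R u u' \<Longrightarrow> word_eq S R v v' \<Longrightarrow> word_eq S R (u @ v) (u' @ v')"
| cancel: "s \<in> S \<Longrightarrow> word_eq S R [(s, b), (s, \<not> b)] []"
| relation: "(l, r) \<in> R \<Longrightarrow> l \<in> words S \<Longrightarrow> r \<in> words S \<Longrightarrow> word_eq S R l r"

definition presented_group :: "'a set \<Rightarrow> ('a word \<times> 'a word) set \<Rightarrow> 'a word set monoid" where
  "presented_group S R =
     \<lparr>carrier = words S // {(u, v). word_eq S R u v},
      monoid.mult = (\<lambda>A B. {w. \<exists>u\<in>A. \<exists>v\<in>B. word_eq S R (u @ v) w}),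
      one = {w. word_eq S R [] w}\<rparr>"

definition racg_relations :: "'a pair_pre_digraph \<Rightarrow> ('a word \<times> 'a word) set" where
  "racg_relations \<Gamma> =
     {([(v, True), (w, True)], [(w, True), (v, True)]) | v w. (v, w) \<in> parcs \<Gamma>} \<union>
     {([(v, True), (v, True)], []) | v. v \<in> pverts \<Gamma>}"

definition racg :: "'a pair_pre_digraph \<Rightarrow> 'a word set monoid" where
  "racg \<Gamma> = presented_group (pverts \<Gamma>) (racg_relations \<Gamma>)"

definition two_power_normal :: "('a, 'm) monoid_scheme \<Rightarrow> 'a set set" where
  "two_power_normal G =
     {N. N \<lhd> G \<and> finite (carrier (G Mod N)) \<and> (\<exists>k::nat. order (G Mod N) = 2 ^ k)}"

text \<open>The compatibility condition says that, for \<open>N \<subseteq> M\<close>, the canonical map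
  \<open>G Mod N \<rightarrow> G Mod M\<close> sends the coset of \<open>g\<close> to the coset of \<open>g\<close>.\<close>

definition pro2_completion :: "('a, 'm) monoid_scheme \<Rightarrow> ('a set \<Rightarrow> 'a set) monoid" where
  "pro2_completion G =
     (product_group (two_power_normal G) (\<lambda>N. G Mod N))
       \<lparr>carrier := {x \<in> (\<Pi>\<^sub>E N\<in>two_power_normal G. carrier (G Mod N)).
          \<forall>N\<in>two_power_normal G. \<forall>M\<in>two_power_normal G. N \<subseteq> M \<longrightarrow>
            (\<forall>g\<in>carrier G. x N = N #>\<^bsub>G\<^esub> g \<longrightarrow> x M = M #>\<^bsub>G\<^esub> g)}\<rparr>"

definition pro2_topology :: "('a, 'm) monoid_scheme \<Rightarrow> ('a set \<Rightarrow> 'a set) topology" where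
  "pro2_topology G =
     subtopology
       (product_topology (\<lambda>N. discrete_topology (carrier (G Mod N))) (two_power_normal G))
       (carrier (pro2_completion G))"

definition topological_group_isomorphic ::
  "('a, 'm) monoid_scheme \<Rightarrow> 'a topology \<Rightarrow> ('b, 'n) monoid_scheme \<Rightarrow> 'b topology \<Rightarrow> bool" where
  "topological_group_isomorphic G X H Y \<longleftrightarrow>
     (\<exists>f. f \<in> Group.iso G H \<and> homeomorphic_map X Y f)"

lemma word_eq_words: "word_eq S R u v \<Longrightarrow> u \<in> words S \<and> v \<in> words S"
  by (induction rule: word_eq.induct) (auto simp: words_def)

lemma equiv_word_eq: "equiv (words S) {(u, v). word_eq S R u v}"
proof (rule equivI)
  show "{(u, v). word_eq S R u v} \<subseteq> words S \<times> words S"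
    using word_eq_words by blast
  show "refl_on (words S) {(u, v). word_eq S R u v}"
    by (rule refl_onI) (simp add: word_eq.refl)
  show "sym {(u, v). word_eq S R u v}"
    using word_eq.sym by (intro symI) blast
  show "trans {(u, v). word_eq S R u v}"
    using word_eq.trans by (intro transI) blast
qed

lemma presented_group_mult_class:
  assumes "u \<in> words S" "v \<in> words S"
  shows "{(u, v). word_eq S R u v} `` {u} \<otimes>\<^bsub>presented_group S R\<^esub> {(u, v). word_eq S R u v} `` {v}
    = {(u, v). word_eq S R u v} `` {u @ v}"
proof -
  have "(\<exists>u'\<in>{w. word_eq S R u w}. \<exists>v'\<in>{w. word_eq S R v w}. word_eq S R (u' @ v') w)
      \<longleftrightarrow> word_eq S R (u @ v) w" for w
  proof
    assume "\<exists>u'\<in>{w. word_eq S R u w}. \<exists>v'\<in>{w. word_eq S R v w}. word_eq S R (u' @ v') w"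
    then obtain u' v' where "word_eq S R u u'" "word_eq S R v v'" "word_eq S R (u' @ v') w"
      by blast
    then show "word_eq S R (u @ v) w" by (meson word_eq.append word_eq.trans)
  next
    assume "word_eq S R (u @ v) w"
    then show "\<exists>u'\<in>{w. word_eq S R u w}. \<exists>v'\<in>{w. word_eq S R v w}. word_eq S R (u' @ v') w"
      using assms word_eq.refl by blast
  qed
  then show ?thesis by (simp add: presented_group_def Image_def)
qed

lemma word_eq_inverse:
  "w \<in> words S \<Longrightarrow> word_eq S R (map (\<lambda>(s, b). (s, \<not> b)) (rev w) @ w) []"
proof (induction w)
  case Nil
  then show ?case by (auto intro: word_eq.refl)
next
  case (Cons a w)
  obtain s b where a: "a = (s, b)" by force
  let ?v = "map (\<lambda>(s, b). (s, \<not> b)) (rev w)"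
  have w: "w \<in> words S" and s: "s \<in> S" and v: "?v \<in> words S"
    using Cons.prems a by (auto simp: words_def)
  have "word_eq S R (?v @ ([(s, \<not> b), (s, \<not> \<not> b)] @ w)) (?v @ ([] @ w))"
    using w s v by (intro word_eq.append word_eq.refl word_eq.cancel)
  then show ?case
    using Cons.IH[OF w] a by (auto intro: word_eq.trans)
qed

lemma group_presented_group: "Group.group (presented_group S R)"
proof (rule groupI)
  let ?E = "{(u, v). word_eq S R u v}"
  have carr: "carrier (presented_group S R) = (\<lambda>u. ?E `` {u}) ` words S"
    by (auto simp: presented_group_def quotient_def)
  have one: "\<one>\<^bsub>presented_group S R\<^esub> = ?E `` {[]}"
    by (auto simp: presented_group_def)
  have app: "u @ v \<in> words S" if "u \<in> words S" "v \<in> words S" for u v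
    using that by (auto simp: words_def)
  have nil: "[] \<in> words S" by (simp add: words_def)
  note mult = presented_group_mult_class[of _ S _ R]
  show "\<one>\<^bsub>presented_group S R\<^esub> \<in> carrier (presented_group S R)"
    using nil carr one by auto
  fix x assume "x \<in> carrier (presented_group S R)"
  then obtain u where u: "u \<in> words S" "x = ?E `` {u}" using carr by auto
  show "\<one>\<^bsub>presented_group S R\<^esub> \<otimes>\<^bsub>presented_group S R\<^esub> x = x"
    unfolding one u(2) by (subst mult[OF nil u(1)]) simp
  let ?i = "map (\<lambda>(s, b). (s, \<not> b)) (rev u)"
  have i: "?i \<in> words S" using u by (auto simp: words_def)
  have "?E `` {?i} \<otimes>\<^bsub>presented_group S R\<^esub> x = ?E `` {?i @ u}"
    unfolding u(2) by (rule mult[OF i u(1)])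
  also have "\<dots> = ?E `` {[]}"
    using word_eq_inverse[OF u(1), of R] by (intro equiv_class_eq[OF equiv_word_eq]) simp
  finally show "\<exists>y\<in>carrier (presented_group S R). y \<otimes>\<^bsub>presented_group S R\<^esub> x = \<one>\<^bsub>presented_group S R\<^esub>"
    using i carr one by auto
  fix y assume "y \<in> carrier (presented_group S R)"
  then obtain v where v: "v \<in> words S" "y = ?E `` {v}" using carr by auto
  show "x \<otimes>\<^bsub>presented_group S R\<^esub> y \<in> carrier (presented_group S R)"
    unfolding u(2) v(2) mult[OF u(1) v(1)] carr using app[OF u(1) v(1)] by blast
  fix z assume "z \<in> carrier (presented_group S R)"
  then obtain w where w: "w \<in> words S" "z = ?E `` {w}" using carr by auto
  show "x \<otimes>\<^bsub>presented_group S R\<^esub> y \<otimes>\<^bsub>presented_group S R\<^esub> z =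
        x \<otimes>\<^bsub>presented_group S R\<^esub> (y \<otimes>\<^bsub>presented_group S R\<^esub> z)"
    unfolding u(2) v(2) w(2) mult[OF u(1) v(1)] mult[OF v(1) w(1)]
      mult[OF app[OF u(1) v(1)] w(1)] mult[OF u(1) app[OF v(1) w(1)]] by simp
qed

lemma (in Group.group) group_pro2_completion: "Group.group (pro2_completion G)"
proof -
  let ?I = "two_power_normal G"
  let ?P = "product_group ?I (\<lambda>N. G Mod N)"
  let ?C = "carrier (pro2_completion G)"
  have nrm: "N \<lhd> G" if "N \<in> ?I" for N using that by (simp add: two_power_normal_def)
  have grp: "Group.group (G Mod N)" if "N \<in> ?I" for N
    using nrm[OF that] by (rule normal.factorgroup_is_group)
  interpret P: Group.group ?P using grp by simp
  have carrier_update: "carrier (K\<lparr>carrier := A\<rparr>) = A" for K :: "('a set \<Rightarrow> 'a set) monoid" and A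
    by simp
  have mem: "x \<in> ?C \<longleftrightarrow> x \<in> carrier ?P \<and> (\<forall>N\<in>?I. \<forall>M\<in>?I. N \<subseteq> M \<longrightarrow>
      (\<forall>g\<in>carrier G. x N = N #> g \<longrightarrow> x M = M #> g))" for x
    unfolding pro2_completion_def carrier_update carrier_product_group by blast
  have compat: "(\<forall>g\<in>carrier G. x N = N #> g \<longrightarrow> x M = M #> g) \<longleftrightarrow>
      (\<exists>g\<in>carrier G. x N = N #> g \<and> x M = M #> g)"
    if x: "x \<in> carrier ?P" and NM: "N \<in> ?I" "M \<in> ?I" "N \<subseteq> M" for x N M
  proof
    assume l: "\<forall>g\<in>carrier G. x N = N #> g \<longrightarrow> x M = M #> g"
    have "x N \<in> rcosets N"
      using x NM(1) by (auto simp: FactGroup_def)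
    then obtain g where "g \<in> carrier G" "x N = N #> g" unfolding RCOSETS_def by blast
    then show "\<exists>g\<in>carrier G. x N = N #> g \<and> x M = M #> g" using l by blast
  next
    assume "\<exists>g\<in>carrier G. x N = N #> g \<and> x M = M #> g"
    then obtain g where g: "g \<in> carrier G" "x N = N #> g" "x M = M #> g" by blast
    have sN: "subgroup N G" and sM: "subgroup M G"
      using nrm NM by (auto simp: normal_def)
    show "\<forall>h\<in>carrier G. x N = N #> h \<longrightarrow> x M = M #> h"
    proof (intro ballI impI)
      fix h assume h: "h \<in> carrier G" "x N = N #> h"
      have "h \<in> N #> g" using rcos_self[OF h(1) sN] h(2) g(2) by metis
      then have "h \<in> M #> g" using NM(3) unfolding r_coset_def by blast
      then have "M #> g = M #> h" using repr_independence[OF _ g(1) sM] by blast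
      then show "x M = M #> h" using g(3) by metis
    qed
  qed
  have C: "x \<in> ?C \<longleftrightarrow> x \<in> carrier ?P \<and> (\<forall>N\<in>?I. \<forall>M\<in>?I. N \<subseteq> M \<longrightarrow>
      (\<exists>g\<in>carrier G. x N = N #> g \<and> x M = M #> g))" for x
    unfolding mem using compat[of x] by meson
  have "subgroup ?C ?P"
  proof (rule P.subgroupI)
    show "?C \<subseteq> carrier ?P" using C by blast
    have "\<one>\<^bsub>?P\<^esub> \<in> ?C"
      unfolding C
    proof (intro conjI ballI impI)
      show "\<one>\<^bsub>?P\<^esub> \<in> carrier ?P" by (rule P.one_closed)
      fix N M assume NM: "N \<in> ?I" "M \<in> ?I"
      then have "N #> \<one> = N" "M #> \<one> = M"
        using nrm by (auto simp: coset_mult_one normal_imp_subgroup subgroup.subset)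
      then show "\<exists>g\<in>carrier G. \<one>\<^bsub>?P\<^esub> N = N #> g \<and> \<one>\<^bsub>?P\<^esub> M = M #> g"
        using NM by (intro bexI[of _ \<one>]) auto
    qed
    then show "?C \<noteq> {}" by blast
    fix x assume x: "x \<in> ?C"
    have xP: "x \<in> carrier ?P" using x C by blast
    show "inv\<^bsub>?P\<^esub> x \<in> ?C"
      unfolding C
    proof (intro conjI ballI impI)
      show "inv\<^bsub>?P\<^esub> x \<in> carrier ?P" using xP by (rule P.inv_closed)
      fix N M assume NM: "N \<in> ?I" "M \<in> ?I" "N \<subseteq> M"
      then obtain g where g: "g \<in> carrier G" "x N = N #> g" "x M = M #> g" using x C by meson
      have "(inv\<^bsub>?P\<^esub> x) K = inv\<^bsub>G Mod K\<^esub> (x K)" if "K \<in> ?I" for K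
        using fun_cong[OF inv_product_group[OF xP[unfolded carrier_product_group] grp], of K] that by simp
      moreover have "inv\<^bsub>G Mod K\<^esub> (K #> g) = K #> inv g" if "K \<in> ?I" for K
        using normal.inv_FactGroup[OF nrm[OF that], of "K #> g"] normal.rcos_inv[OF nrm[OF that] g(1)] g(1)
        by (auto simp: FactGroup_def RCOSETS_def)
      ultimately show "\<exists>g\<in>carrier G. (inv\<^bsub>?P\<^esub> x) N = N #> g \<and> (inv\<^bsub>?P\<^esub> x) M = M #> g"
        using NM g by (intro bexI[of _ "inv g"]) auto
    qed
    fix y assume y: "y \<in> ?C"
    have yP: "y \<in> carrier ?P" using y C by blast
    show "x \<otimes>\<^bsub>?P\<^esub> y \<in> ?C"
      unfolding C
    proof (intro conjI ballI impI)
      show "x \<otimes>\<^bsub>?P\<^esub> y \<in> carrier ?P" using xP yP by (rule P.m_closed)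
      fix N M assume NM: "N \<in> ?I" "M \<in> ?I" "N \<subseteq> M"
      then obtain g where g: "g \<in> carrier G" "x N = N #> g" "x M = M #> g" using x C by meson
      obtain h where h: "h \<in> carrier G" "y N = N #> h" "y M = M #> h" using NM y C by meson
      have "(x \<otimes>\<^bsub>?P\<^esub> y) N = N #> (g \<otimes> h)" "(x \<otimes>\<^bsub>?P\<^esub> y) M = M #> (g \<otimes> h)"
        using NM g h normal.rcos_sum[OF nrm] by (auto simp: FactGroup_def)
      then show "\<exists>g\<in>carrier G. (x \<otimes>\<^bsub>?P\<^esub> y) N = N #> g \<and> (x \<otimes>\<^bsub>?P\<^esub> y) M = M #> g"
        using g h by (intro bexI[of _ "g \<otimes> h"]) auto
    qed
  qed
  moreover have "pro2_completion G = ?P\<lparr>carrier := ?C\<rparr>"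
    by (simp add: pro2_completion_def)
  ultimately show ?thesis using P.subgroup_imp_group by metis
qed

lemma topspace_pro2_topology: "topspace (pro2_topology G) = carrier (pro2_completion G)"
  by (auto simp: pro2_topology_def pro2_completion_def)

end

theory Submission
  imports Defs "Jordan_Normal_Form.Determinant" "HOL-Library.Z2"
begin

text \<open>A topological isomorphism of the completions identifies \<open>Hom(C(\<Gamma>), P)\<close> with \<open>Hom(C(\<Gamma>'), P)\<close>,
  naturally in the finite 2-group \<open>P\<close>. For \<open>P\<close> of order 2 this is a linear bijection \<open>T\<close> between the
  spaces of functions from the vertex sets to the field with two elements. Two such functions \<open>f\<close>,
  \<open>g\<close> have disjoint supports with no arc between them iff \<open>(f, g)\<close> lifts to a homomorphism to the
  Heisenberg group of order 8, so \<open>T\<close> preserves this relation. A nonzero term in the Leibniz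
  expansion of \<open>det T\<close> is a bijection \<open>\<sigma>\<close> of the vertices with \<open>T e\<^sub>v (\<sigma> v) \<noteq> 0\<close> for all \<open>v\<close>;
  it maps nonadjacent pairs to nonadjacent pairs. The same holds in the other direction, so the
  numbers of nonadjacent pairs agree and \<open>\<sigma>\<close> is an isomorphism.\<close>

section \<open>Pro-2 completions\<close>

definition finite_2_group :: "('a, 'm) monoid_scheme \<Rightarrow> bool" where
  "finite_2_group P \<longleftrightarrow> Group.group P \<and> finite (carrier P) \<and> (\<exists>k::nat. Coset.order P = 2 ^ k)"

lemma finite_2_group_imp_group: "finite_2_group P \<Longrightarrow> Group.group P"
  by (simp add: finite_2_group_def)

lemma two_power_normal_iff:
  "N \<in> two_power_normal G \<longleftrightarrow> N \<lhd> G \<and> finite_2_group (G Mod N)"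
  by (auto simp: two_power_normal_def finite_2_group_def normal.factorgroup_is_group)

lemma finite_2_group_DirProd:
  assumes "finite_2_group P" "finite_2_group Q"
  shows "finite_2_group (P \<times>\<times> Q)"
proof -
  obtain k l :: nat where "Coset.order P = 2 ^ k" "Coset.order Q = 2 ^ l"
    using assms by (auto simp: finite_2_group_def)
  then have "Coset.order (P \<times>\<times> Q) = 2 ^ (k + l)"
    by (simp add: Coset.order_def card_cartesian_product power_add)
  then show ?thesis
    using assms by (auto simp: finite_2_group_def DirProd_group)
qed

text \<open>By the first isomorphism theorem the quotient by the kernel is the image of
  \<open>h\<close>, a subgroup of \<open>P\<close>, and by Lagrange its order divides a power of
  2.\<close>

lemma kernel_in_two_power_normal:
  assumes G: "Group.group G" and P: "finite_2_group P" and h: "h \<in> hom G P"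
  shows "kernel G P h \<in> two_power_normal G"
proof -
  \<comment> \<open>The codomain is cut down to the image so that \<open>h\<close> becomes
    surjective, as the first isomorphism theorem requires.\<close>
  let ?I = "P\<lparr>carrier := h ` carrier G\<rparr>"
  have gP: "Group.group P" and fP: "finite (carrier P)" using P by (auto simp: finite_2_group_def)
  interpret h: group_hom G P h using G gP h by (simp add: group_hom_def group_hom_axioms_def)
  have sub: "subgroup (h ` carrier G) P" by (rule h.img_is_subgroup)
  then have "Group.group ?I" by (rule subgroup.subgroup_is_group) (rule gP)
  then interpret i: group_hom G ?I h
    using G h by (auto simp: group_hom_def group_hom_axioms_def hom_def)
  have ker: "kernel G ?I h = kernel G P h" by (simp add: kernel_def)
  have iso: "(\<lambda>X. the_elem (h ` X)) \<in> Group.iso (G Mod kernel G P h) ?I"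
    using i.FactGroup_iso_set ker by simp
  have "bij_betw (\<lambda>X. the_elem (h ` X)) (carrier (G Mod kernel G P h)) (h ` carrier G)"
    using iso by (simp add: Group.iso_def)
  then have fin: "finite (carrier (G Mod kernel G P h)) = finite (h ` carrier G)"
    and card: "Coset.order (G Mod kernel G P h) = card (h ` carrier G)"
    using bij_betw_finite bij_betw_same_card unfolding Coset.order_def by blast+
  have "card (h ` carrier G) dvd Coset.order P"
    using group.lagrange[OF gP sub] by (metis dvd_triv_right)
  then have "\<exists>k. card (h ` carrier G) = 2 ^ k"
    using P divides_primepow_nat[of 2] two_is_prime_nat by (auto simp: finite_2_group_def)
  moreover have "finite (h ` carrier G)"
    using sub fP finite_subset subgroup.subset by blast
  ultimately show ?thesis
    using fin card h.normal_kernel by (simp add: two_power_normal_def)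
qed

text \<open>The intersection is the kernel of the diagonal map to the product of the two quotients,
  and that product is again a finite 2-group.\<close>

lemma Int_in_two_power_normal:
  assumes G: "Group.group G" and N: "N \<in> two_power_normal G" and M: "M \<in> two_power_normal G"
  shows "N \<inter> M \<in> two_power_normal G"
proof -
  have n: "N \<lhd> G" "M \<lhd> G" using N M by (auto simp: two_power_normal_iff)
  let ?P = "(G Mod N) \<times>\<times> (G Mod M)"
  let ?h = "\<lambda>g. (N #>\<^bsub>G\<^esub> g, M #>\<^bsub>G\<^esub> g)"
  have "(\<lambda>g. N #>\<^bsub>G\<^esub> g) \<in> hom G (G Mod N)" "(\<lambda>g. M #>\<^bsub>G\<^esub> g) \<in> hom G (G Mod M)"
    using n by (auto intro: normal.r_coset_hom_Mod)
  then have h: "?h \<in> hom G ?P" by (auto simp: hom_def)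
  have eq: "K #>\<^bsub>G\<^esub> g = K \<longleftrightarrow> g \<in> K" if "K \<lhd> G" "g \<in> carrier G" for K g
    using that G group.coset_join1 group.coset_join2 normal_imp_subgroup subgroup.rcos_const by metis
  have sub: "N \<subseteq> carrier G" "M \<subseteq> carrier G" using n by (meson normal_imp_subgroup subgroup.subset)+
  have "kernel G ?P ?h = N \<inter> M" using eq n sub by (auto simp: kernel_def)
  then show ?thesis
    using kernel_in_two_power_normal[OF G finite_2_group_DirProd h] N M
    by (simp add: two_power_normal_iff)
qed

lemma carrier_in_two_power_normal:
  assumes G: "Group.group G"
  shows "carrier G \<in> two_power_normal G"
proof -
  have P: "finite_2_group (singleton_group ())"
    by (auto simp: finite_2_group_def Coset.order_def intro!: exI[of _ 0])
  have "(\<lambda>_. ()) \<in> hom G (singleton_group ())" by (simp add: hom_def)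
  from kernel_in_two_power_normal[OF G P this] show ?thesis by (simp add: kernel_def)
qed

text \<open>The index system is directed downwards, so finitely many coordinates of a point of the
  completion are controlled by a single one.\<close>

lemma finite_family_two_power_normal:
  assumes G: "Group.group G" and "finite I" "I \<subseteq> two_power_normal G"
  shows "\<exists>M\<in>two_power_normal G. \<forall>N\<in>I. M \<subseteq> N"
  using assms(2,3)
proof (induction I)
  case empty
  then show ?case using carrier_in_two_power_normal[OF G] by blast
next
  case (insert N I)
  then obtain M where "M \<in> two_power_normal G" "\<forall>K\<in>I. M \<subseteq> K" by auto
  then show ?case
    using insert.prems Int_in_two_power_normal[OF G, of N M] by (intro bexI[of _ "N \<inter> M"]) auto
qed

section \<open>Points of the completion and the dense image of the group\<close>

lemma pro2_completion_carrier:
  "x \<in> carrier (pro2_completion G) \<longleftrightarrow>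
    x \<in> (\<Pi>\<^sub>E N\<in>two_power_normal G. carrier (G Mod N)) \<and>
    (\<forall>N\<in>two_power_normal G. \<forall>M\<in>two_power_normal G. N \<subseteq> M \<longrightarrow>
      (\<forall>g\<in>carrier G. x N = N #>\<^bsub>G\<^esub> g \<longrightarrow> x M = M #>\<^bsub>G\<^esub> g))"
  by (simp add: pro2_completion_def)

lemma pro2_completion_mult:
  "N \<in> two_power_normal G \<Longrightarrow>
    (x \<otimes>\<^bsub>pro2_completion G\<^esub> y) N = x N \<otimes>\<^bsub>G Mod N\<^esub> y N"
  by (simp add: pro2_completion_def)

lemma pro2_completion_compatible:
  assumes "x \<in> carrier (pro2_completion G)" "N \<in> two_power_normal G" "M \<in> two_power_normal G"
    "N \<subseteq> M" "g \<in> carrier G" "x N = N #>\<^bsub>G\<^esub> g"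
  shows "x M = M #>\<^bsub>G\<^esub> g"
  using assms unfolding pro2_completion_carrier by blast

text \<open>A representative of the coordinate at a common lower bound \<open>M\<close> represents
  all coordinates in \<open>I\<close> by compatibility. This is the density of the image of
  \<open>G\<close>: every later evaluation at a point of the completion is reduced to a group
  element in this way.\<close>

lemma pro2_completion_approx:
  assumes G: "Group.group G" and x: "x \<in> carrier (pro2_completion G)"
    and I: "finite I" "I \<subseteq> two_power_normal G"
  shows "\<exists>g\<in>carrier G. \<forall>N\<in>I. x N = N #>\<^bsub>G\<^esub> g"
proof -
  obtain M where M: "M \<in> two_power_normal G" "\<forall>N\<in>I. M \<subseteq> N"
    using finite_family_two_power_normal[OF G I] by blast
  have "x M \<in> carrier (G Mod M)" using x M(1) by (auto simp: pro2_completion_carrier)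
  then obtain g where "g \<in> carrier G" "x M = M #>\<^bsub>G\<^esub> g"
    by (auto simp: carrier_FactGroup)
  then show ?thesis using x M I by (meson pro2_completion_carrier subsetD)
qed

lemma pro2_completion_coset:
  assumes "Group.group G" "x \<in> carrier (pro2_completion G)" "N \<in> two_power_normal G"
  obtains g where "g \<in> carrier G" "x N = N #>\<^bsub>G\<^esub> g"
  using pro2_completion_approx[OF assms(1,2), of "{N}"] assms(3) by auto

text \<open>The canonical map from \<open>G\<close> to its completion. Points of the completion are
  extensional functions, hence the restricted lambda.\<close>

definition pro2_unit :: "('a, 'm) monoid_scheme \<Rightarrow> 'a \<Rightarrow> 'a set \<Rightarrow> 'a set" where
  "pro2_unit G g = (\<lambda>N\<in>two_power_normal G. N #>\<^bsub>G\<^esub> g)"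

lemma pro2_unit_closed:
  assumes G: "Group.group G" and g: "g \<in> carrier G"
  shows "pro2_unit G g \<in> carrier (pro2_completion G)"
  unfolding pro2_completion_carrier
proof (intro conjI ballI impI)
  show "pro2_unit G g \<in> (\<Pi>\<^sub>E N\<in>two_power_normal G. carrier (G Mod N))"
    using g by (auto simp: pro2_unit_def carrier_FactGroup)
  fix N M h
  assume *: "N \<in> two_power_normal G" "M \<in> two_power_normal G" "N \<subseteq> M" "h \<in> carrier G"
    "pro2_unit G g N = N #>\<^bsub>G\<^esub> h"
  then have s: "subgroup N G" "subgroup M G"
    by (auto simp: two_power_normal_iff normal_imp_subgroup)
  have "h \<in> N #>\<^bsub>G\<^esub> g" using * s G by (metis group.rcos_self pro2_unit_def restrict_apply')
  then have "h \<in> M #>\<^bsub>G\<^esub> g" using *(3) unfolding r_coset_def by blast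
  then show "pro2_unit G g M = M #>\<^bsub>G\<^esub> h"
    using group.repr_independence[OF G _ g s(2)] *(2) by (simp add: pro2_unit_def)
qed

lemma pro2_unit_hom:
  assumes G: "Group.group G"
  shows "pro2_unit G \<in> hom G (pro2_completion G)"
proof (rule homI)
  fix g h assume gh: "g \<in> carrier G" "h \<in> carrier G"
  have "pro2_unit G (g \<otimes>\<^bsub>G\<^esub> h) N = (pro2_unit G g \<otimes>\<^bsub>pro2_completion G\<^esub> pro2_unit G h) N" for N
    using gh normal.rcos_sum[of N G g h]
    by (cases "N \<in> two_power_normal G")
      (auto simp: pro2_completion_mult pro2_unit_def two_power_normal_iff pro2_completion_def)
  then show "pro2_unit G (g \<otimes>\<^bsub>G\<^esub> h) = pro2_unit G g \<otimes>\<^bsub>pro2_completion G\<^esub> pro2_unit G h" ..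
qed (rule pro2_unit_closed[OF G])

section \<open>Extending homomorphisms into finite 2-groups to the completion\<close>

text \<open>The continuous extension of \<open>h\<close> along \<open>pro2_unit\<close>. The
  coordinate of \<open>x\<close> at the kernel is a coset on which \<open>h\<close> is constant, and
  \<open>the_elem\<close> extracts this constant.\<close>

definition pro2_extend ::
  "('a, 'm) monoid_scheme \<Rightarrow> ('p, 'n) monoid_scheme \<Rightarrow> ('a \<Rightarrow> 'p) \<Rightarrow> ('a set \<Rightarrow> 'a set) \<Rightarrow> 'p" where
  "pro2_extend G P h x = the_elem (h ` x (kernel G P h))"

text \<open>Compatibility carries a representative at \<open>N\<close> over to the kernel. Admitting
  every \<open>N\<close> below the kernel lets one group element evaluate the extensions of several
  homomorphisms at once.\<close>

lemma pro2_extend_eq: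
  assumes G: "Group.group G" and P: "finite_2_group P" and h: "h \<in> hom G P"
    and x: "x \<in> carrier (pro2_completion G)"
    and N: "N \<in> two_power_normal G" "N \<subseteq> kernel G P h"
    and g: "g \<in> carrier G" "x N = N #>\<^bsub>G\<^esub> g"
  shows "pro2_extend G P h x = h g"
proof -
  interpret h: group_hom G P h
    using G P h by (simp add: group_hom_def group_hom_axioms_def finite_2_group_def)
  have K: "kernel G P h \<in> two_power_normal G" by (rule kernel_in_two_power_normal[OF G P h])
  have "x (kernel G P h) = kernel G P h #>\<^bsub>G\<^esub> g"
    by (rule pro2_completion_compatible[OF x N(1) K N(2) g])
  moreover have "h ` (kernel G P h #>\<^bsub>G\<^esub> g) = {h g}"
  proof -
    have "g \<in> kernel G P h #>\<^bsub>G\<^esub> g"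
      using g(1) h.subgroup_kernel by (rule h.G.rcos_self)
    then show ?thesis
      using g(1) by (auto simp: r_coset_def kernel_def image_iff)
  qed
  ultimately show ?thesis by (simp add: pro2_extend_def)
qed

lemma pro2_extend_unit:
  assumes G: "Group.group G" and P: "finite_2_group P" and h: "h \<in> hom G P" and g: "g \<in> carrier G"
  shows "pro2_extend G P h (pro2_unit G g) = h g"
  using kernel_in_two_power_normal[OF G P h]
  by (intro pro2_extend_eq[OF G P h pro2_unit_closed[OF G g] _ subset_refl g]) (auto simp: pro2_unit_def)

text \<open>Homomorphisms are total functions, and uniqueness on generators gives equality on the
  carrier only; this carries such an equality over to the extensions.\<close>

lemma pro2_extend_cong:
  assumes G: "Group.group G" and P: "finite_2_group P" and h: "h \<in> hom G P"
    and eq: "\<And>g. g \<in> carrier G \<Longrightarrow> k g = h g" and x: "x \<in> carrier (pro2_completion G)"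
  shows "pro2_extend G P k x = pro2_extend G P h x"
proof -
  have k: "k \<in> hom G P" using h G by (auto simp: hom_def eq group.is_monoid monoid.m_closed)
  have K: "kernel G P h \<in> two_power_normal G" by (rule kernel_in_two_power_normal[OF G P h])
  have sub: "kernel G P h \<subseteq> kernel G P k" by (auto simp: kernel_def eq)
  obtain g where g: "g \<in> carrier G" "x (kernel G P h) = kernel G P h #>\<^bsub>G\<^esub> g"
    using pro2_completion_coset[OF G x K] .
  show ?thesis
    using pro2_extend_eq[OF G P h x K subset_refl g] pro2_extend_eq[OF G P k x K sub g] eq[OF g(1)]
    by simp
qed

text \<open>The kernel of \<open>h\<close> lies in that of \<open>a \<circ> h\<close>, so a
  representative of \<open>x\<close> at the kernel of \<open>h\<close> evaluates both sides.\<close>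

lemma pro2_extend_natural:
  assumes G: "Group.group G" and P: "finite_2_group P" and Q: "finite_2_group Q"
    and h: "h \<in> hom G P" and a: "a \<in> hom P Q" and x: "x \<in> carrier (pro2_completion G)"
  shows "pro2_extend G Q (a \<circ> h) x = a (pro2_extend G P h x)"
proof -
  have K: "kernel G P h \<in> two_power_normal G" by (rule kernel_in_two_power_normal[OF G P h])
  obtain g where g: "g \<in> carrier G" "x (kernel G P h) = kernel G P h #>\<^bsub>G\<^esub> g"
    using pro2_completion_coset[OF G x K] .
  have "a \<one>\<^bsub>P\<^esub> = \<one>\<^bsub>Q\<^esub>" using a P Q by (simp add: hom_one finite_2_group_imp_group)
  then have "kernel G P h \<subseteq> kernel G Q (a \<circ> h)" by (auto simp: kernel_def)
  then have "pro2_extend G Q (a \<circ> h) x = (a \<circ> h) g"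
    using g by (intro pro2_extend_eq[OF G Q hom_compose[OF h a] x K])
  moreover have "pro2_extend G P h x = h g"
    using g by (intro pro2_extend_eq[OF G P h x K]) auto
  ultimately show ?thesis by simp
qed

lemma pro2_extend_hom:
  assumes G: "Group.group G" and P: "finite_2_group P" and h: "h \<in> hom G P"
  shows "pro2_extend G P h \<in> hom (pro2_completion G) P"
proof (rule homI)
  let ?K = "kernel G P h"
  have K: "?K \<in> two_power_normal G" by (rule kernel_in_two_power_normal[OF G P h])
  note ext = pro2_extend_eq[OF G P h _ K subset_refl]
  fix x assume x: "x \<in> carrier (pro2_completion G)"
  obtain g where g: "g \<in> carrier G" "x ?K = ?K #>\<^bsub>G\<^esub> g"
    using pro2_completion_coset[OF G x K] .
  then show "pro2_extend G P h x \<in> carrier P" using ext[OF x g] h by (auto simp: hom_def)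
  fix y assume y: "y \<in> carrier (pro2_completion G)"
  obtain k where k: "k \<in> carrier G" "y ?K = ?K #>\<^bsub>G\<^esub> k"
    using pro2_completion_coset[OF G y K] .
  have xy: "x \<otimes>\<^bsub>pro2_completion G\<^esub> y \<in> carrier (pro2_completion G)"
    using x y group.group_pro2_completion[OF G] by (simp add: group.is_monoid monoid.m_closed)
  have gk: "g \<otimes>\<^bsub>G\<^esub> k \<in> carrier G" using g k G by (simp add: group.is_monoid monoid.m_closed)
  have "(x \<otimes>\<^bsub>pro2_completion G\<^esub> y) ?K = ?K #>\<^bsub>G\<^esub> (g \<otimes>\<^bsub>G\<^esub> k)"
    using K g k normal.rcos_sum[of ?K G g k] by (simp add: pro2_completion_mult two_power_normal_iff)
  from ext[OF xy gk this]
  show "pro2_extend G P h (x \<otimes>\<^bsub>pro2_completion G\<^esub> y)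
      = pro2_extend G P h x \<otimes>\<^bsub>P\<^esub> pro2_extend G P h y"
    using ext[OF x g] ext[OF y k] hom_mult[OF h g(1) k(1)] by simp
qed

text \<open>The extension factors through the projection to the coordinate at the kernel, followed
  by a map between discrete spaces.\<close>

lemma pro2_extend_continuous:
  assumes G: "Group.group G" and P: "finite_2_group P" and h: "h \<in> hom G P"
  shows "continuous_map (pro2_topology G) (discrete_topology (carrier P)) (pro2_extend G P h)"
proof -
  let ?K = "kernel G P h"
  have K: "?K \<in> two_power_normal G" by (rule kernel_in_two_power_normal[OF G P h])
  have c: "continuous_map (pro2_topology G) (discrete_topology (carrier (G Mod ?K))) (\<lambda>x. x ?K)"
    unfolding pro2_topology_def
    using continuous_map_product_projection[OF K, of "\<lambda>N. discrete_topology (carrier (G Mod N))"]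
    by (rule continuous_map_from_subtopology)
  have "the_elem (h ` c) \<in> carrier P" if "c \<in> carrier (G Mod ?K)" for c
    using that group_hom.FactGroup_the_elem_mem[of G P h c] G P h
    by (simp add: group_hom_def group_hom_axioms_def finite_2_group_def)
  then have "continuous_map (discrete_topology (carrier (G Mod ?K))) (discrete_topology (carrier P))
      (\<lambda>c. the_elem (h ` c))"
    by auto
  from continuous_map_compose[OF c this] show ?thesis
    by (simp add: pro2_extend_def[abs_def] o_def)
qed

text \<open>A continuous map to a discrete group is determined on the dense image of
  \<open>G\<close>: the fibre of \<open>t\<close> through \<open>x\<close> is open, so it contains
  all points of the completion in some basic neighbourhood of \<open>x\<close>. Such a neighbourhood
  constrains finitely many coordinates, and an approximating \<open>g\<close> meets these
  constraints.\<close>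

lemma pro2_extend_unique:
  assumes G: "Group.group G" and P: "finite_2_group P"
    and t: "t \<in> hom (pro2_completion G) P"
    and c: "continuous_map (pro2_topology G) (discrete_topology (carrier P)) t"
    and x: "x \<in> carrier (pro2_completion G)"
  shows "pro2_extend G P (t \<circ> pro2_unit G) x = t x"
proof -
  let ?h = "t \<circ> pro2_unit G" and ?I = "two_power_normal G"
  let ?X = "\<lambda>N. discrete_topology (carrier (G Mod N))"
  have h: "?h \<in> hom G P" using hom_compose[OF pro2_unit_hom[OF G] t] .
  have K: "kernel G P ?h \<in> ?I" by (rule kernel_in_two_power_normal[OF G P h])
  have tx: "t x \<in> carrier P" using t x by (auto simp: hom_def)
  have "openin (pro2_topology G) {y \<in> topspace (pro2_topology G). t y \<in> {t x}}"
    using tx by (intro openin_continuous_map_preimage[OF c]) auto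
  then have "openin (pro2_topology G) {y \<in> carrier (pro2_completion G). t y = t x}"
    by (simp add: topspace_pro2_topology)
  then obtain T where T: "openin (product_topology ?X ?I) T"
    and eq: "{y \<in> carrier (pro2_completion G). t y = t x} = T \<inter> carrier (pro2_completion G)"
    unfolding pro2_topology_def openin_subtopology by blast
  have "x \<in> T" using eq x by blast
  then obtain U where U: "finite {N \<in> ?I. U N \<noteq> topspace (?X N)}" "x \<in> Pi\<^sub>E ?I U" "Pi\<^sub>E ?I U \<subseteq> T"
    using T unfolding openin_product_topology_alt by meson
  \<comment> \<open>The kernel joins the finitely many constrained coordinates so that the same
    \<open>g\<close> also evaluates the extension at \<open>x\<close>.\<close>
  obtain g where g: "g \<in> carrier G"
    "\<forall>N \<in> insert (kernel G P ?h) {N \<in> ?I. U N \<noteq> topspace (?X N)}. x N = N #>\<^bsub>G\<^esub> g"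
    using pro2_completion_approx[OF G x, of "insert (kernel G P ?h) {N \<in> ?I. U N \<noteq> topspace (?X N)}"]
      U(1) K by auto
  have u: "pro2_unit G g \<in> carrier (pro2_completion G)" by (rule pro2_unit_closed[OF G g(1)])
  have "pro2_unit G g N \<in> U N" if N: "N \<in> ?I" for N
  proof (cases "U N = topspace (?X N)")
    case True
    then show ?thesis using u N by (auto simp: pro2_completion_carrier)
  next
    case False
    then have "pro2_unit G g N = x N" using g N by (simp add: pro2_unit_def)
    then show ?thesis using U(2) N by auto
  qed
  then have "pro2_unit G g \<in> Pi\<^sub>E ?I U" by (auto simp: pro2_unit_def)
  then have "t (pro2_unit G g) = t x" using U(3) u eq by blast
  moreover have "pro2_extend G P ?h x = ?h g"
    using g by (intro pro2_extend_eq[OF G P h x K]) auto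
  ultimately show ?thesis by simp
qed

section \<open>Pulling homomorphisms back along continuous homomorphisms of completions\<close>

definition pro2_hom ::
  "('a, 'm) monoid_scheme \<Rightarrow> ('b, 'n) monoid_scheme \<Rightarrow> (('a set \<Rightarrow> 'a set) \<Rightarrow> 'b set \<Rightarrow> 'b set) \<Rightarrow> bool"
  where "pro2_hom G H E \<longleftrightarrow>
    E \<in> hom (pro2_completion G) (pro2_completion H) \<and>
    continuous_map (pro2_topology G) (pro2_topology H) E"

lemma pro2_hom_closed:
  "pro2_hom G H E \<Longrightarrow> x \<in> carrier (pro2_completion G) \<Longrightarrow> E x \<in> carrier (pro2_completion H)"
  by (auto simp: pro2_hom_def hom_def)

text \<open>Extend \<open>h\<close> to the completion of \<open>H\<close>, compose with
  \<open>E\<close>, and restrict to \<open>G\<close>. This is how a map of completions acts on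
  homomorphisms of the discrete groups into \<open>P\<close>, contravariantly.\<close>

definition pro2_pullback ::
  "('a, 'm) monoid_scheme \<Rightarrow> ('b, 'n) monoid_scheme \<Rightarrow> ('p, 'q) monoid_scheme \<Rightarrow>
    (('a set \<Rightarrow> 'a set) \<Rightarrow> 'b set \<Rightarrow> 'b set) \<Rightarrow> ('b \<Rightarrow> 'p) \<Rightarrow> 'a \<Rightarrow> 'p"
  where "pro2_pullback G H P E h = (pro2_extend H P h \<circ> E) \<circ> pro2_unit G"

context
  fixes G :: "('a, 'm) monoid_scheme" and H :: "('b, 'n) monoid_scheme"
    and P :: "('p, 'q) monoid_scheme"
    and E :: "('a set \<Rightarrow> 'a set) \<Rightarrow> 'b set \<Rightarrow> 'b set" and h :: "'b \<Rightarrow> 'p"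
  assumes G: "Group.group G" and H: "Group.group H" and P: "finite_2_group P"
    and E: "pro2_hom G H E" and h: "h \<in> hom H P"
begin

lemma pro2_extend_comp_hom: "pro2_extend H P h \<circ> E \<in> hom (pro2_completion G) P"
  using E by (intro hom_compose[OF _ pro2_extend_hom[OF H P h]]) (simp add: pro2_hom_def)

lemma pro2_pullback_hom: "pro2_pullback G H P E h \<in> hom G P"
  unfolding pro2_pullback_def by (rule hom_compose[OF pro2_unit_hom[OF G] pro2_extend_comp_hom])

text \<open>Extending the pullback recovers the map that was restricted to \<open>G\<close>, since
  that map is a continuous homomorphism and \<open>pro2_extend_unique\<close> applies.\<close>

lemma pro2_extend_pullback:
  assumes x: "x \<in> carrier (pro2_completion G)"
  shows "pro2_extend G P (pro2_pullback G H P E h) x = pro2_extend H P h (E x)"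
proof -
  have "continuous_map (pro2_topology G) (discrete_topology (carrier P)) (pro2_extend H P h \<circ> E)"
    using E pro2_extend_continuous[OF H P h] unfolding pro2_hom_def
    by (blast intro: continuous_map_compose)
  from pro2_extend_unique[OF G P pro2_extend_comp_hom this x] show ?thesis
    by (simp add: pro2_pullback_def)
qed

lemma pro2_pullback_natural:
  assumes Q: "finite_2_group Q" and a: "a \<in> hom P Q" and g: "g \<in> carrier G"
  shows "pro2_pullback G H Q E (a \<circ> h) g = a (pro2_pullback G H P E h g)"
  using pro2_extend_natural[OF H P Q h a pro2_hom_closed[OF E pro2_unit_closed[OF G g]]]
  by (simp add: pro2_pullback_def)

text \<open>By \<open>pro2_extend_pullback\<close> the successive pullbacks amount to evaluating the
  extension of \<open>h\<close> at \<open>E (E' y)\<close> with \<open>y\<close> the image of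
  \<open>k\<close>, which is \<open>y\<close> itself.\<close>

lemma pro2_pullback_inverse:
  assumes E': "pro2_hom H G E'" and inverse: "\<And>y. y \<in> carrier (pro2_completion H) \<Longrightarrow> E (E' y) = y"
    and k: "k \<in> carrier H"
  shows "pro2_pullback H G P E' (pro2_pullback G H P E h) k = h k"
proof -
  have u: "pro2_unit H k \<in> carrier (pro2_completion H)" by (rule pro2_unit_closed[OF H k])
  show ?thesis
    using pro2_extend_pullback[OF pro2_hom_closed[OF E' u]] inverse[OF u] pro2_extend_unit[OF H P h k]
    by (simp add: pro2_pullback_def[of H])
qed

end

lemma pro2_pullback_cong:
  assumes G: "Group.group G" and H: "Group.group H" and P: "finite_2_group P"
    and E: "pro2_hom G H E" and h: "h \<in> hom H P"
    and eq: "\<And>y. y \<in> carrier H \<Longrightarrow> k y = h y" and g: "g \<in> carrier G"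
  shows "pro2_pullback G H P E k g = pro2_pullback G H P E h g"
  using pro2_extend_cong[OF H P h eq pro2_hom_closed[OF E pro2_unit_closed[OF G g]]]
  by (simp add: pro2_pullback_def)

section \<open>Functoriality of the completion\<close>

text \<open>Each coordinate is the extension of \<open>f\<close> followed by a quotient map, so
  multiplicativity and continuity are inherited from \<open>pro2_extend\<close> coordinate by
  coordinate.\<close>

definition pro2_map ::
  "('a, 'm) monoid_scheme \<Rightarrow> ('b, 'n) monoid_scheme \<Rightarrow> ('a \<Rightarrow> 'b) \<Rightarrow> ('a set \<Rightarrow> 'a set) \<Rightarrow> 'b set \<Rightarrow> 'b set"
  where "pro2_map G H f x =
    (\<lambda>M\<in>two_power_normal H. pro2_extend G (H Mod M) (\<lambda>g. M #>\<^bsub>H\<^esub> f g) x)"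

lemma coset_hom:
  assumes "M \<in> two_power_normal H" "f \<in> hom G H"
  shows "(\<lambda>g. M #>\<^bsub>H\<^esub> f g) \<in> hom G (H Mod M)"
  using hom_compose[OF assms(2) normal.r_coset_hom_Mod[of M H]] assms(1)
  by (simp add: two_power_normal_iff o_def)

text \<open>One \<open>g\<close> serves on both sides: besides the coordinates in \<open>I\<close>,
  the point \<open>x\<close> is approximated at the kernels of the maps from \<open>G\<close> to
  \<open>H Mod M\<close> for \<open>M\<close> in \<open>J\<close>.\<close>

lemma pro2_map_approx:
  assumes G: "Group.group G" and f: "f \<in> hom G H" and x: "x \<in> carrier (pro2_completion G)"
    and I: "finite I" "I \<subseteq> two_power_normal G" and J: "finite J" "J \<subseteq> two_power_normal H"
  shows "\<exists>g\<in>carrier G. (\<forall>N\<in>I. x N = N #>\<^bsub>G\<^esub> g) \<and> (\<forall>M\<in>J. pro2_map G H f x M = M #>\<^bsub>H\<^esub> f g)"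
proof -
  let ?h = "\<lambda>M g. M #>\<^bsub>H\<^esub> f g"
  let ?K = "\<lambda>M. kernel G (H Mod M) (?h M)"
  have Q: "finite_2_group (H Mod M)" and h: "?h M \<in> hom G (H Mod M)" if "M \<in> J" for M
    using that J coset_hom[OF _ f] by (auto simp: two_power_normal_iff)
  have K: "?K M \<in> two_power_normal G" if "M \<in> J" for M
    using kernel_in_two_power_normal[OF G Q[OF that] h[OF that]] .
  obtain g where g: "g \<in> carrier G" "\<forall>N\<in>I \<union> ?K ` J. x N = N #>\<^bsub>G\<^esub> g"
    using pro2_completion_approx[OF G x, of "I \<union> ?K ` J"] I J K by auto
  have "pro2_map G H f x M = M #>\<^bsub>H\<^esub> f g" if M: "M \<in> J" for M
  proof -
    have "pro2_extend G (H Mod M) (?h M) x = ?h M g"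
      using g M by (intro pro2_extend_eq[OF G Q h x K]) auto
    then show ?thesis using M J by (auto simp: pro2_map_def)
  qed
  then show ?thesis using g by blast
qed

lemma pro2_map_hom:
  assumes G: "Group.group G" and H: "Group.group H" and f: "f \<in> hom G H"
  shows "pro2_hom G H (pro2_map G H f)"
proof -
  let ?h = "\<lambda>M g. M #>\<^bsub>H\<^esub> f g"
  have Q: "finite_2_group (H Mod M)" and h: "?h M \<in> hom G (H Mod M)"
    if "M \<in> two_power_normal H" for M
    using that coset_hom[OF _ f] by (auto simp: two_power_normal_iff)
  have closed: "pro2_map G H f x \<in> carrier (pro2_completion H)"
    if x: "x \<in> carrier (pro2_completion G)" for x
    unfolding pro2_completion_carrier
  proof (intro conjI ballI impI)
    show "pro2_map G H f x \<in> (\<Pi>\<^sub>E M\<in>two_power_normal H. carrier (H Mod M))"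
      using hom_in_carrier[OF pro2_extend_hom[OF G Q h] x] by (simp add: pro2_map_def)
    fix M L k
    assume *: "M \<in> two_power_normal H" "L \<in> two_power_normal H" "M \<subseteq> L" "k \<in> carrier H"
      "pro2_map G H f x M = M #>\<^bsub>H\<^esub> k"
    obtain g where g: "g \<in> carrier G" "pro2_map G H f x M = M #>\<^bsub>H\<^esub> f g"
      "pro2_map G H f x L = L #>\<^bsub>H\<^esub> f g"
      using pro2_map_approx[OF G f x, of "{}" "{M, L}"] * by auto
    \<comment> \<open>The coordinates at \<open>M\<close> and \<open>L\<close> agree with those of
      \<open>pro2_unit H (f g)\<close>, a point already known to be compatible.\<close>
    have "f g \<in> carrier H" using f g(1) by (auto simp: hom_def)
    from pro2_completion_compatible[OF pro2_unit_closed[OF H this] *(1-4)]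
    show "pro2_map G H f x L = L #>\<^bsub>H\<^esub> k"
      using * g by (simp add: pro2_unit_def)
  qed
  have "pro2_map G H f \<in> hom (pro2_completion G) (pro2_completion H)"
  proof (rule homI)
    fix x y assume xy: "x \<in> carrier (pro2_completion G)" "y \<in> carrier (pro2_completion G)"
    have "pro2_map G H f (x \<otimes>\<^bsub>pro2_completion G\<^esub> y) M =
        (pro2_map G H f x \<otimes>\<^bsub>pro2_completion H\<^esub> pro2_map G H f y) M" for M
      using hom_mult[OF pro2_extend_hom[OF G Q h] xy]
      by (cases "M \<in> two_power_normal H") (simp_all add: pro2_completion_def pro2_map_def)
    then show "pro2_map G H f (x \<otimes>\<^bsub>pro2_completion G\<^esub> y) =
        pro2_map G H f x \<otimes>\<^bsub>pro2_completion H\<^esub> pro2_map G H f y" ..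
  qed (rule closed)
  moreover have "continuous_map (pro2_topology G)
      (product_topology (\<lambda>M. discrete_topology (carrier (H Mod M))) (two_power_normal H)) (pro2_map G H f)"
    unfolding continuous_map_componentwise
  proof (intro conjI ballI)
    show "pro2_map G H f ` topspace (pro2_topology G) \<subseteq> extensional (two_power_normal H)"
      by (auto simp: pro2_map_def)
    fix M assume M: "M \<in> two_power_normal H"
    show "continuous_map (pro2_topology G) (discrete_topology (carrier (H Mod M))) (\<lambda>x. pro2_map G H f x M)"
      using M pro2_extend_continuous[OF G Q[OF M] h[OF M]] by (simp add: pro2_map_def)
  qed
  then have "continuous_map (pro2_topology G) (pro2_topology H) (pro2_map G H f)"
    using closed unfolding pro2_topology_def[of H]
    by (auto simp: continuous_map_in_subtopology topspace_pro2_topology)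
  ultimately show ?thesis by (simp add: pro2_hom_def)
qed

text \<open>At a coordinate \<open>N\<close>, choose \<open>g\<close> representing \<open>x\<close>
  there and such that \<open>f g\<close> represents the image of \<open>x\<close> at the kernel of
  the map from \<open>H\<close> to \<open>G Mod N\<close>. Then the left-hand side is the coset of
  \<open>f' (f g)\<close>, which is that of \<open>g\<close>.\<close>

lemma pro2_map_inverse:
  assumes G: "Group.group G" and H: "Group.group H" and f: "f \<in> hom G H" and f': "f' \<in> hom H G"
    and inverse: "\<And>g. g \<in> carrier G \<Longrightarrow> f' (f g) = g" and x: "x \<in> carrier (pro2_completion G)"
  shows "pro2_map H G f' (pro2_map G H f x) = x"
proof
  fix N
  show "pro2_map H G f' (pro2_map G H f x) N = x N"
  proof (cases "N \<in> two_power_normal G")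
    case N: True
    let ?h = "\<lambda>k. N #>\<^bsub>G\<^esub> f' k"
    let ?K = "kernel H (G Mod N) ?h"
    have Q: "finite_2_group (G Mod N)" and h: "?h \<in> hom H (G Mod N)"
      using N coset_hom[OF _ f'] by (auto simp: two_power_normal_iff)
    have K: "?K \<in> two_power_normal H" by (rule kernel_in_two_power_normal[OF H Q h])
    obtain g where g: "g \<in> carrier G" "x N = N #>\<^bsub>G\<^esub> g" "pro2_map G H f x ?K = ?K #>\<^bsub>H\<^esub> f g"
      using pro2_map_approx[OF G f x, of "{N}" "{?K}"] N K by auto
    have "pro2_map G H f x \<in> carrier (pro2_completion H)"
      by (rule pro2_hom_closed[OF pro2_map_hom[OF G H f] x])
    moreover have "f g \<in> carrier H" using f g(1) by (auto simp: hom_def)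
    ultimately have "pro2_extend H (G Mod N) ?h (pro2_map G H f x) = ?h (f g)"
      using g K by (intro pro2_extend_eq[OF H Q h _ K]) auto
    then show ?thesis using N g inverse by (simp add: pro2_map_def[of H])
  next
    case False
    \<comment> \<open>Outside the index system both sides are \<open>undefined\<close>, because
      points of the completion are extensional.\<close>
    then show ?thesis using x by (auto simp: pro2_map_def pro2_completion_carrier)
  qed
qed

section \<open>Topological isomorphisms as pairs of inverse continuous homomorphisms\<close>

lemma topological_group_isomorphic_pro2I:
  assumes G: "Group.group G" and H: "Group.group H" and f: "f \<in> hom G H" and f': "f' \<in> hom H G"
    and "\<And>g. g \<in> carrier G \<Longrightarrow> f' (f g) = g" "\<And>k. k \<in> carrier H \<Longrightarrow> f (f' k) = k"
  shows "topological_group_isomorphic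
    (pro2_completion G) (pro2_topology G) (pro2_completion H) (pro2_topology H)"
proof -
  let ?F = "pro2_map G H f" and ?F' = "pro2_map H G f'"
  have F: "pro2_hom G H ?F" "pro2_hom H G ?F'"
    using pro2_map_hom[OF G H f] pro2_map_hom[OF H G f'] .
  have inv: "\<And>x. x \<in> carrier (pro2_completion G) \<Longrightarrow> ?F' (?F x) = x"
    "\<And>y. y \<in> carrier (pro2_completion H) \<Longrightarrow> ?F (?F' y) = y"
    using pro2_map_inverse assms by metis+
  have "bij_betw ?F (carrier (pro2_completion G)) (carrier (pro2_completion H))"
    using inv pro2_hom_closed[OF F(1)] pro2_hom_closed[OF F(2)]
    by (intro bij_betw_byWitness[where f' = ?F']) auto
  then have "?F \<in> Group.iso (pro2_completion G) (pro2_completion H)"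
    using F by (simp add: Group.iso_def pro2_hom_def)
  moreover have "homeomorphic_maps (pro2_topology G) (pro2_topology H) ?F ?F'"
    using F inv by (auto simp: homeomorphic_maps_def pro2_hom_def topspace_pro2_topology)
  ultimately show ?thesis
    unfolding topological_group_isomorphic_def by (metis homeomorphic_map_maps)
qed

text \<open>The inverse \<open>E'\<close> is taken from the homeomorphism, which makes it
  continuous; it is multiplicative because \<open>E\<close> is multiplicative and \<open>E'\<close>
  cancels \<open>E\<close>.\<close>

lemma topological_group_isomorphic_pro2E:
  assumes G: "Group.group G" and H: "Group.group H"
    and "topological_group_isomorphic
      (pro2_completion G) (pro2_topology G) (pro2_completion H) (pro2_topology H)"
  obtains E E' where "pro2_hom G H E" "pro2_hom H G E'"
    "\<And>x. x \<in> carrier (pro2_completion G) \<Longrightarrow> E' (E x) = x"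
    "\<And>y. y \<in> carrier (pro2_completion H) \<Longrightarrow> E (E' y) = y"
proof -
  obtain E where iso: "E \<in> Group.iso (pro2_completion G) (pro2_completion H)"
    and hm: "homeomorphic_map (pro2_topology G) (pro2_topology H) E"
    using assms(3) unfolding topological_group_isomorphic_def by blast
  obtain E' where m: "homeomorphic_maps (pro2_topology G) (pro2_topology H) E E'"
    using hm homeomorphic_map_maps by blast
  then have inv: "\<And>x. x \<in> carrier (pro2_completion G) \<Longrightarrow> E' (E x) = x"
    "\<And>y. y \<in> carrier (pro2_completion H) \<Longrightarrow> E (E' y) = y"
    and c: "continuous_map (pro2_topology G) (pro2_topology H) E"
    "continuous_map (pro2_topology H) (pro2_topology G) E'"
    by (auto simp: homeomorphic_maps_def topspace_pro2_topology)
  have E: "E \<in> hom (pro2_completion G) (pro2_completion H)" using iso by (simp add: Group.iso_def)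
  have E'_closed: "E' y \<in> carrier (pro2_completion G)" if "y \<in> carrier (pro2_completion H)" for y
    using c(2) that topspace_pro2_topology[of H] topspace_pro2_topology[of G]
    by (metis continuous_map_image_subset_topspace image_subset_iff)
  have "E' \<in> hom (pro2_completion H) (pro2_completion G)"
  proof (rule homI)
    fix y z assume yz: "y \<in> carrier (pro2_completion H)" "z \<in> carrier (pro2_completion H)"
    have "E (E' y \<otimes>\<^bsub>pro2_completion G\<^esub> E' z) = y \<otimes>\<^bsub>pro2_completion H\<^esub> z"
      using hom_mult[OF E E'_closed[OF yz(1)] E'_closed[OF yz(2)]] inv yz by simp
    moreover have "E' y \<otimes>\<^bsub>pro2_completion G\<^esub> E' z \<in> carrier (pro2_completion G)"
      using E'_closed yz group.group_pro2_completion[OF G] by (simp add: group.is_monoid monoid.m_closed)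
    ultimately show "E' (y \<otimes>\<^bsub>pro2_completion H\<^esub> z) = E' y \<otimes>\<^bsub>pro2_completion G\<^esub> E' z"
      using inv(1) by metis
  qed (rule E'_closed)
  then show thesis using that E c inv by (simp add: pro2_hom_def)
qed

section \<open>Presented groups and right-angled Coxeter groups\<close>

definition presented_gen :: "'a set \<Rightarrow> ('a word \<times> 'a word) set \<Rightarrow> 'a \<Rightarrow> 'a word set" where
  "presented_gen S R s = {(u, v). word_eq S R u v} `` {[(s, True)]}"

definition word_eval :: "('p, 'm) monoid_scheme \<Rightarrow> ('a \<Rightarrow> 'p) \<Rightarrow> 'a word \<Rightarrow> 'p" where
  "word_eval P f w =
    foldr (\<lambda>(s, b) p. (if b then f s else inv\<^bsub>P\<^esub> f s) \<otimes>\<^bsub>P\<^esub> p) w \<one>\<^bsub>P\<^esub>"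

text \<open>The guards mirror the rule \<open>relation\<close> of \<open>word_eq\<close>, which uses
  a pair only when both words are over \<open>S\<close>.\<close>

definition satisfies_relations ::
  "('p, 'm) monoid_scheme \<Rightarrow> ('a \<Rightarrow> 'p) \<Rightarrow> 'a set \<Rightarrow> ('a word \<times> 'a word) set \<Rightarrow> bool" where
  "satisfies_relations P f S R \<longleftrightarrow>
    (\<forall>(l, r)\<in>R. l \<in> words S \<longrightarrow> r \<in> words S \<longrightarrow> word_eval P f l = word_eval P f r)"

text \<open>\<open>the_elem\<close> returns the common value of \<open>word_eval\<close> on a class;
  there is one as soon as the relations hold in \<open>P\<close>.\<close>

definition presented_lift :: "('p, 'm) monoid_scheme \<Rightarrow> ('a \<Rightarrow> 'p) \<Rightarrow> 'a word set \<Rightarrow> 'p" where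
  "presented_lift P f A = the_elem (word_eval P f ` A)"

lemma presented_group_carrier:
  "carrier (presented_group S R) = (\<lambda>w. {(u, v). word_eq S R u v} `` {w}) ` words S"
  by (auto simp: presented_group_def quotient_def)

lemma presented_group_one: "\<one>\<^bsub>presented_group S R\<^esub> = {(u, v). word_eq S R u v} `` {[]}"
  by (auto simp: presented_group_def)

lemma presented_gen_closed: "s \<in> S \<Longrightarrow> presented_gen S R s \<in> carrier (presented_group S R)"
  by (auto simp: presented_gen_def presented_group_carrier words_def)

context
  fixes P :: "('p, 'm) monoid_scheme" and S :: "'a set" and f :: "'a \<Rightarrow> 'p"
  assumes P: "Group.group P" and f: "\<And>s. s \<in> S \<Longrightarrow> f s \<in> carrier P"
begin

interpretation P: Group.group P by (rule P)

lemma word_eval_closed: "w \<in> words S \<Longrightarrow> word_eval P f w \<in> carrier P"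
  by (induction w) (auto simp: word_eval_def words_def f)

lemma word_eval_append:
  "u \<in> words S \<Longrightarrow> v \<in> words S \<Longrightarrow>
    word_eval P f (u @ v) = word_eval P f u \<otimes>\<^bsub>P\<^esub> word_eval P f v"
proof (induction u)
  case Nil
  then show ?case using word_eval_closed[of v] by (simp add: word_eval_def)
next
  case (Cons a u)
  then have u: "u \<in> words S" and a: "fst a \<in> S" by (auto simp: words_def)
  have "word_eval P f ((a # u) @ v) =
      (if snd a then f (fst a) else inv\<^bsub>P\<^esub> f (fst a)) \<otimes>\<^bsub>P\<^esub> word_eval P f (u @ v)"
    by (simp add: word_eval_def case_prod_beta)
  then show ?case
    using Cons.IH[OF u] Cons.prems(2) word_eval_closed[OF u] word_eval_closed[of v] f[OF a]
    by (simp add: word_eval_def case_prod_beta P.m_assoc)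
qed

lemma word_eval_word_eq:
  assumes R: "satisfies_relations P f S R"
  shows "word_eq S R u v \<Longrightarrow> word_eval P f u = word_eval P f v"
proof (induction rule: word_eq.induct)
  case (append u u' v v')
  then have "u \<in> words S" "u' \<in> words S" "v \<in> words S" "v' \<in> words S"
    using word_eq_words by blast+
  then show ?case using append.IH by (simp add: word_eval_append)
next
  case (cancel s b)
  then show ?case using f by (cases b) (simp_all add: word_eval_def)
qed (use R in \<open>auto simp: satisfies_relations_def\<close>)

lemma presented_lift_class:
  assumes R: "satisfies_relations P f S R"
    and w: "w \<in> words S"
  shows "presented_lift P f ({(u, v). word_eq S R u v} `` {w}) = word_eval P f w"
proof -
  let ?A = "{(u, v). word_eq S R u v} `` {w}"
  have "word_eval P f v = word_eval P f w" if "v \<in> ?A" for v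
    using word_eval_word_eq[OF R word_eq.sym] that by blast
  moreover have "w \<in> ?A" using word_eq.refl[OF w] by blast
  ultimately have "word_eval P f ` ?A = {word_eval P f w}" by blast
  then show ?thesis by (simp add: presented_lift_def)
qed

text \<open>Von Dyck's theorem: evaluation is constant on classes and turns concatenation into
  multiplication.\<close>

lemma presented_lift_hom:
  assumes R: "satisfies_relations P f S R"
  shows "presented_lift P f \<in> hom (presented_group S R) P"
proof (rule homI)
  let ?c = "\<lambda>w. {(u, v). word_eq S R u v} `` {w}"
  note lift = presented_lift_class[OF R]
  fix x assume "x \<in> carrier (presented_group S R)"
  then obtain u where u: "u \<in> words S" "x = ?c u" by (auto simp: presented_group_carrier)
  show "presented_lift P f x \<in> carrier P" using lift[OF u(1)] word_eval_closed[OF u(1)] u(2) by simp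
  fix y assume "y \<in> carrier (presented_group S R)"
  then obtain v where v: "v \<in> words S" "y = ?c v" by (auto simp: presented_group_carrier)
  have uv: "u @ v \<in> words S" using u v by (auto simp: words_def)
  have "x \<otimes>\<^bsub>presented_group S R\<^esub> y = ?c (u @ v)"
    unfolding u(2) v(2) by (rule presented_group_mult_class[OF u(1) v(1)])
  then show "presented_lift P f (x \<otimes>\<^bsub>presented_group S R\<^esub> y) =
      presented_lift P f x \<otimes>\<^bsub>P\<^esub> presented_lift P f y"
    using lift[OF uv] lift[OF u(1)] lift[OF v(1)] u v word_eval_append by simp
qed

lemma presented_lift_gen:
  assumes R: "satisfies_relations P f S R"
    and s: "s \<in> S"
  shows "presented_lift P f (presented_gen S R s) = f s"
proof -
  have "[(s, True)] \<in> words S" using s by (simp add: words_def)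
  from presented_lift_class[OF R this] show ?thesis
    using f[OF s] by (simp add: presented_gen_def word_eval_def)
qed

end

text \<open>Agreement on generators passes to formal inverse letters and then to all words by
  induction on their length.\<close>

lemma presented_hom_unique:
  assumes P: "Group.group P"
    and h: "h \<in> hom (presented_group S R) P" and k: "k \<in> hom (presented_group S R) P"
    and gen: "\<And>s. s \<in> S \<Longrightarrow> h (presented_gen S R s) = k (presented_gen S R s)"
    and x: "x \<in> carrier (presented_group S R)"
  shows "h x = k x"
proof -
  let ?G = "presented_group S R" and ?c = "\<lambda>w. {(u, v). word_eq S R u v} `` {w}"
  interpret h: group_hom ?G P h
    using P h group_presented_group by (auto simp: group_hom_def group_hom_axioms_def)
  interpret k: group_hom ?G P k
    using P k group_presented_group by (auto simp: group_hom_def group_hom_axioms_def)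
  have letter: "h (?c [(s, b)]) = k (?c [(s, b)])" if s: "s \<in> S" for s b
  proof (cases b)
    case True
    then show ?thesis using gen[OF s] by (simp add: presented_gen_def)
  next
    case False
    have w: "[(s, True)] \<in> words S" "[(s, False)] \<in> words S" using s by (auto simp: words_def)
    \<comment> \<open>The cancellation rule makes the class of the formal inverse letter a left
      inverse of the generator, hence its group inverse.\<close>
    have "?c [(s, False)] \<otimes>\<^bsub>?G\<^esub> presented_gen S R s = ?c ([(s, False)] @ [(s, True)])"
      unfolding presented_gen_def by (rule presented_group_mult_class[OF w(2) w(1)])
    also have "\<dots> = \<one>\<^bsub>?G\<^esub>"
      unfolding presented_group_one using word_eq.cancel[OF s, of R False]
      by (intro equiv_class_eq[OF equiv_word_eq]) simp
    finally have "?c [(s, False)] = inv\<^bsub>?G\<^esub> presented_gen S R s"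
      using w presented_gen_closed[OF s]
      by (intro h.G.inv_equality[symmetric]) (auto simp: presented_group_carrier)
    then show ?thesis
      using False gen[OF s] presented_gen_closed[OF s] by simp
  qed
  have "h (?c w) = k (?c w)" if "w \<in> words S" for w
    using that
  proof (induction w)
    case Nil
    show ?case unfolding presented_group_one[symmetric] by (simp only: h.hom_one k.hom_one)
  next
    case (Cons a w)
    obtain s b where a: "a = (s, b)" by force
    have w: "w \<in> words S" and s: "s \<in> S" and a': "[a] \<in> words S"
      using Cons.prems a by (auto simp: words_def)
    have "?c (a # w) = ?c [a] \<otimes>\<^bsub>?G\<^esub> ?c w"
      using presented_group_mult_class[OF a' w, of R] by simp
    moreover have "?c [a] \<in> carrier ?G" "?c w \<in> carrier ?G"
      using a' w by (auto simp: presented_group_carrier)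
    ultimately show ?case using Cons.IH[OF w] letter[OF s, of b] a by simp
  qed
  then show ?thesis using x by (auto simp: presented_group_carrier)
qed

section \<open>The universal property of right-angled Coxeter groups\<close>

definition racg_gen :: "'a pair_pre_digraph \<Rightarrow> 'a \<Rightarrow> 'a word set" where
  "racg_gen \<Gamma> = presented_gen (pverts \<Gamma>) (racg_relations \<Gamma>)"

text \<open>For a graph \<open>\<Gamma>\<close> and a group \<open>P\<close>, these are the
  restrictions to the generators of the homomorphisms from \<open>racg \<Gamma>\<close> to
  \<open>P\<close>.\<close>

definition racg_map :: "'a pair_pre_digraph \<Rightarrow> ('p, 'm) monoid_scheme \<Rightarrow> ('a \<Rightarrow> 'p) \<Rightarrow> bool" where
  "racg_map \<Gamma> P f \<longleftrightarrow>
    (\<forall>v\<in>pverts \<Gamma>. f v \<in> carrier P \<and> f v \<otimes>\<^bsub>P\<^esub> f v = \<one>\<^bsub>P\<^esub>) \<and>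
    (\<forall>(v, w)\<in>parcs \<Gamma>. f v \<otimes>\<^bsub>P\<^esub> f w = f w \<otimes>\<^bsub>P\<^esub> f v)"

lemma racg_mapI:
  assumes "\<And>v. v \<in> pverts \<Gamma> \<Longrightarrow> f v \<in> carrier P"
    and "\<And>v. v \<in> pverts \<Gamma> \<Longrightarrow> f v \<otimes>\<^bsub>P\<^esub> f v = \<one>\<^bsub>P\<^esub>"
    and "\<And>v w. (v, w) \<in> parcs \<Gamma> \<Longrightarrow> f v \<otimes>\<^bsub>P\<^esub> f w = f w \<otimes>\<^bsub>P\<^esub> f v"
  shows "racg_map \<Gamma> P f"
  using assms unfolding racg_map_def by auto

lemma racg_mapD:
  assumes "racg_map \<Gamma> P f"
  shows "v \<in> pverts \<Gamma> \<Longrightarrow> f v \<in> carrier P"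
    and "v \<in> pverts \<Gamma> \<Longrightarrow> f v \<otimes>\<^bsub>P\<^esub> f v = \<one>\<^bsub>P\<^esub>"
    and "(v, w) \<in> parcs \<Gamma> \<Longrightarrow> f v \<otimes>\<^bsub>P\<^esub> f w = f w \<otimes>\<^bsub>P\<^esub> f v"
  using assms unfolding racg_map_def by auto

lemma group_racg: "Group.group (racg \<Gamma>)"
  by (simp add: racg_def group_presented_group)

lemma racg_gen_closed: "v \<in> pverts \<Gamma> \<Longrightarrow> racg_gen \<Gamma> v \<in> carrier (racg \<Gamma>)"
  by (simp add: racg_gen_def racg_def presented_gen_closed)

lemma racg_hom_unique:
  assumes "Group.group P" "h \<in> hom (racg \<Gamma>) P" "k \<in> hom (racg \<Gamma>) P"
    and "\<And>v. v \<in> pverts \<Gamma> \<Longrightarrow> h (racg_gen \<Gamma> v) = k (racg_gen \<Gamma> v)" "x \<in> carrier (racg \<Gamma>)"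
  shows "h x = k x"
  using assms unfolding racg_def racg_gen_def by (rule presented_hom_unique)

lemma racg_lift:
  assumes P: "Group.group P" and f: "racg_map \<Gamma> P f"
  shows racg_lift_hom: "presented_lift P f \<in> hom (racg \<Gamma>) P"
    and racg_lift_gen: "v \<in> pverts \<Gamma> \<Longrightarrow> presented_lift P f (racg_gen \<Gamma> v) = f v"
proof -
  interpret P: Group.group P by (rule P)
  have c: "f s \<in> carrier P" if "s \<in> pverts \<Gamma>" for s using f that by (auto simp: racg_map_def)
  have R: "satisfies_relations P f (pverts \<Gamma>) (racg_relations \<Gamma>)"
    using f by (auto simp: satisfies_relations_def racg_relations_def racg_map_def word_eval_def words_def)
  show "presented_lift P f \<in> hom (racg \<Gamma>) P"
    unfolding racg_def using P c R by (rule presented_lift_hom)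
  show "presented_lift P f (racg_gen \<Gamma> v) = f v" if "v \<in> pverts \<Gamma>"
    unfolding racg_gen_def using P c R that by (rule presented_lift_gen)
qed

lemma racg_gen_map:
  assumes "pair_graph \<Gamma>"
  shows "racg_map \<Gamma> (racg \<Gamma>) (racg_gen \<Gamma>)"
proof -
  interpret pair_graph \<Gamma> by fact
  let ?S = "pverts \<Gamma>" and ?R = "racg_relations \<Gamma>"
  let ?c = "\<lambda>w. {(u, v). word_eq ?S ?R u v} `` {w}"
  have mult: "racg_gen \<Gamma> v \<otimes>\<^bsub>racg \<Gamma>\<^esub> racg_gen \<Gamma> w = ?c [(v, True), (w, True)]"
    if "v \<in> ?S" "w \<in> ?S" for v w
    unfolding racg_gen_def racg_def presented_gen_def
    using presented_group_mult_class[of "[(v, True)]" ?S "[(w, True)]" ?R] that by (simp add: words_def)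
  have eq: "?c l = ?c r" if "(l, r) \<in> ?R" "l \<in> words ?S" "r \<in> words ?S" for l r
    using that word_eq.relation by (intro equiv_class_eq[OF equiv_word_eq]) auto
  have "racg_gen \<Gamma> v \<otimes>\<^bsub>racg \<Gamma>\<^esub> racg_gen \<Gamma> v = \<one>\<^bsub>racg \<Gamma>\<^esub>" if v: "v \<in> ?S" for v
    unfolding mult[OF v v] unfolding racg_def presented_group_one
    using v by (intro eq) (auto simp: racg_relations_def words_def)
  moreover have "racg_gen \<Gamma> v \<otimes>\<^bsub>racg \<Gamma>\<^esub> racg_gen \<Gamma> w = racg_gen \<Gamma> w \<otimes>\<^bsub>racg \<Gamma>\<^esub> racg_gen \<Gamma> v"
    if a: "(v, w) \<in> parcs \<Gamma>" for v w
  proof -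
    have vw: "v \<in> ?S" "w \<in> ?S" using a arc_fst_in_verts arc_snd_in_verts by force+
    show ?thesis
      unfolding mult[OF vw] mult[OF vw(2,1)]
      using vw a by (intro eq) (auto simp: racg_relations_def words_def)
  qed
  ultimately show ?thesis by (intro racg_mapI racg_gen_closed)
qed

lemma racg_map_hom:
  assumes \<Gamma>: "pair_graph \<Gamma>" and h: "h \<in> hom (racg \<Gamma>) P" and P: "Group.group P"
  shows "racg_map \<Gamma> P (\<lambda>v. h (racg_gen \<Gamma> v))"
proof -
  interpret pair_graph \<Gamma> by fact
  have gen: "racg_map \<Gamma> (racg \<Gamma>) (racg_gen \<Gamma>)" by (rule racg_gen_map[OF \<Gamma>])
  have mult: "h (racg_gen \<Gamma> v) \<otimes>\<^bsub>P\<^esub> h (racg_gen \<Gamma> w) = h (racg_gen \<Gamma> v \<otimes>\<^bsub>racg \<Gamma>\<^esub> racg_gen \<Gamma> w)"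
    if "v \<in> pverts \<Gamma>" "w \<in> pverts \<Gamma>" for v w
    using hom_mult[OF h racg_gen_closed racg_gen_closed] that by simp
  have ends: "v \<in> pverts \<Gamma>" "w \<in> pverts \<Gamma>" if "(v, w) \<in> parcs \<Gamma>" for v w
    using that arc_fst_in_verts arc_snd_in_verts by force+
  show ?thesis
  proof (rule racg_mapI)
    show "h (racg_gen \<Gamma> v) \<in> carrier P" if "v \<in> pverts \<Gamma>" for v
      by (rule hom_in_carrier[OF h racg_gen_closed[OF that]])
    show "h (racg_gen \<Gamma> v) \<otimes>\<^bsub>P\<^esub> h (racg_gen \<Gamma> v) = \<one>\<^bsub>P\<^esub>" if "v \<in> pverts \<Gamma>" for v
      unfolding mult[OF that that] racg_mapD(2)[OF gen that] by (rule hom_one[OF h group_racg P])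
    show "h (racg_gen \<Gamma> v) \<otimes>\<^bsub>P\<^esub> h (racg_gen \<Gamma> w) = h (racg_gen \<Gamma> w) \<otimes>\<^bsub>P\<^esub> h (racg_gen \<Gamma> v)"
      if "(v, w) \<in> parcs \<Gamma>" for v w
      using racg_mapD(3)[OF gen that] mult ends[OF that] by simp
  qed
qed

section \<open>Isomorphic graphs have isomorphic completions\<close>

text \<open>The vertex bijection and its inverse respect the relations, so they induce homomorphisms
  of the Coxeter groups; these are mutually inverse because they are so on generators, and the
  completion is functorial.\<close>

lemma digraph_iso_imp_pro2_isomorphic:
  assumes \<Gamma>: "pair_graph \<Gamma>" and \<Gamma>': "pair_graph \<Gamma>'"
    and iso: "digraph_iso (with_proj \<Gamma>) (with_proj \<Gamma>')"
  shows "topological_group_isomorphic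
    (pro2_completion (racg \<Gamma>)) (pro2_topology (racg \<Gamma>))
    (pro2_completion (racg \<Gamma>')) (pro2_topology (racg \<Gamma>'))"
proof -
  interpret \<Gamma>: pair_graph \<Gamma> by fact
  interpret \<Gamma>': pair_graph \<Gamma>' by fact
  obtain i where i: "pre_digraph.digraph_isomorphism (with_proj \<Gamma>) i"
    and eq: "with_proj \<Gamma>' = app_iso i (with_proj \<Gamma>)"
    using iso by (auto simp: digraph_iso_def)
  let ?s = "iso_verts i"
  define t where "t = inv_into (pverts \<Gamma>) ?s"
  \<comment> \<open>\<open>app_iso\<close> takes its tail and head maps from \<open>i\<close>. Both
    graphs use the projections, so these maps are \<open>fst\<close> and \<open>snd\<close>, and the
    arc map is determined by the vertex map.\<close>
  have verts: "pverts \<Gamma>' = ?s ` pverts \<Gamma>" and arcs: "parcs \<Gamma>' = iso_arcs i ` parcs \<Gamma>"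
    and "iso_tail i = fst" "iso_head i = snd"
    using arg_cong[OF eq, of verts] arg_cong[OF eq, of arcs] arg_cong[OF eq, of tail]
      arg_cong[OF eq, of head] by simp_all
  then have inj: "inj_on ?s (pverts \<Gamma>)" and "\<forall>a\<in>parcs \<Gamma>. iso_arcs i a = (?s (fst a), ?s (snd a))"
    using i by (auto simp: pre_digraph.digraph_isomorphism_def prod_eq_iff)
  then have arcs': "parcs \<Gamma>' = (\<lambda>(v, w). (?s v, ?s w)) ` parcs \<Gamma>"
    using arcs by (auto simp: case_prod_beta)
  have t: "t (?s v) = v" if "v \<in> pverts \<Gamma>" for v using inj that by (simp add: t_def)
  have ends: "v \<in> pverts \<Gamma>" "w \<in> pverts \<Gamma>" if "(v, w) \<in> parcs \<Gamma>" for v w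
    using that \<Gamma>.arc_fst_in_verts \<Gamma>.arc_snd_in_verts by force+
  have f: "racg_map \<Gamma> (racg \<Gamma>') (\<lambda>v. racg_gen \<Gamma>' (?s v))"
    by (rule racg_mapI; rule racg_mapD[OF racg_gen_map[OF \<Gamma>']]; use verts arcs' in force)
  have f': "racg_map \<Gamma>' (racg \<Gamma>) (\<lambda>v. racg_gen \<Gamma> (t v))"
  proof (rule racg_mapI)
    fix v w assume "(v, w) \<in> parcs \<Gamma>'"
    then obtain v' w' where a: "(v', w') \<in> parcs \<Gamma>" "v = ?s v'" "w = ?s w'" using arcs' by auto
    then show "racg_gen \<Gamma> (t v) \<otimes>\<^bsub>racg \<Gamma>\<^esub> racg_gen \<Gamma> (t w) =
        racg_gen \<Gamma> (t w) \<otimes>\<^bsub>racg \<Gamma>\<^esub> racg_gen \<Gamma> (t v)"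
      using racg_mapD(3)[OF racg_gen_map[OF \<Gamma>] a(1)] t ends[OF a(1)] by simp
  qed (use racg_mapD(1,2)[OF racg_gen_map[OF \<Gamma>]] verts t in auto)
  let ?f = "presented_lift (racg \<Gamma>') (\<lambda>v. racg_gen \<Gamma>' (?s v))"
  let ?f' = "presented_lift (racg \<Gamma>) (\<lambda>v. racg_gen \<Gamma> (t v))"
  note hom = racg_lift_hom[OF group_racg f] racg_lift_hom[OF group_racg f']
  note gen = racg_lift_gen[OF group_racg f] racg_lift_gen[OF group_racg f']
  have id: "(\<lambda>x. x) \<in> hom (racg \<Delta>) (racg \<Delta>)" for \<Delta> :: "'c pair_pre_digraph"
    by (simp add: hom_def)
  show ?thesis
  proof (rule topological_group_isomorphic_pro2I[OF group_racg group_racg hom])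
    show "?f' (?f x) = x" if "x \<in> carrier (racg \<Gamma>)" for x
      using racg_hom_unique[OF group_racg hom_compose[OF hom] id _ that] gen t verts by simp
    have "(?f \<circ> ?f') (racg_gen \<Gamma>' v) = racg_gen \<Gamma>' v" if v: "v \<in> pverts \<Gamma>'" for v
    proof -
      obtain v' where v': "v' \<in> pverts \<Gamma>" "v = ?s v'" using v verts by blast
      then show ?thesis using gen(1)[OF v'(1)] gen(2)[OF v] t[OF v'(1)] by simp
    qed
    from racg_hom_unique[OF group_racg hom_compose[OF hom(2,1)] id this]
    show "?f (?f' x) = x" if "x \<in> carrier (racg \<Gamma>')" for x using that by simp
  qed
qed

section \<open>Groups of order 2, 4 and 8\<close>

definition additive_group :: "'a::ab_group_add monoid" where
  "additive_group = \<lparr>carrier = UNIV, monoid.mult = (+), one = 0\<rparr>"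

lemma additive_group_simps [simp]:
  "carrier additive_group = UNIV" "x \<otimes>\<^bsub>additive_group\<^esub> y = x + y" "\<one>\<^bsub>additive_group\<^esub> = 0"
  by (simp_all add: additive_group_def)

lemma group_additive_group: "Group.group (additive_group :: 'a::ab_group_add monoid)"
proof (rule groupI)
  show "\<exists>y\<in>carrier additive_group. y \<otimes>\<^bsub>additive_group\<^esub> x = \<one>\<^bsub>additive_group\<^esub>" for x :: 'a
    by (auto intro: exI[of _ "- x"])
qed (auto simp: add.assoc)

text \<open>Naturality along these three maps from the square of a group is what makes pullbacks
  additive.\<close>

lemma additive_group_hom:
  "fst \<in> hom (additive_group :: ('a::ab_group_add \<times> 'a) monoid) additive_group"
  "snd \<in> hom (additive_group :: ('a \<times> 'a) monoid) additive_group"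
  "(\<lambda>x. fst x + snd x) \<in> hom (additive_group :: ('a \<times> 'a) monoid) additive_group"
  by (simp_all add: hom_def algebra_simps)

text \<open>The unitriangular 3 by 3 matrices with \<open>a\<close>, \<open>b\<close> next to the
  diagonal and \<open>c\<close> in the corner. Over \<open>bit\<close> this is the dihedral group of
  order 8.\<close>

definition heisenberg_group :: "('a::comm_ring \<times> 'a \<times> 'a) monoid" where
  "heisenberg_group = \<lparr>carrier = UNIV,
     monoid.mult = (\<lambda>(a, b, c) (a', b', c'). (a + a', b + b', c + c' + a * b')), one = (0, 0, 0)\<rparr>"

lemma heisenberg_group_simps [simp]:
  "carrier heisenberg_group = UNIV"
  "(a, b, c) \<otimes>\<^bsub>heisenberg_group\<^esub> (a', b', c') = (a + a', b + b', c + c' + a * b')"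
  "\<one>\<^bsub>heisenberg_group\<^esub> = (0, 0, 0)"
  by (simp_all add: heisenberg_group_def)

lemma group_heisenberg_group: "Group.group (heisenberg_group :: ('a::comm_ring \<times> 'a \<times> 'a) monoid)"
proof (rule groupI)
  fix x y z :: "'a \<times> 'a \<times> 'a"
  show "x \<otimes>\<^bsub>heisenberg_group\<^esub> y \<otimes>\<^bsub>heisenberg_group\<^esub> z =
      x \<otimes>\<^bsub>heisenberg_group\<^esub> (y \<otimes>\<^bsub>heisenberg_group\<^esub> z)"
    by (cases x; cases y; cases z) (simp add: algebra_simps)
  show "\<one>\<^bsub>heisenberg_group\<^esub> \<otimes>\<^bsub>heisenberg_group\<^esub> x = x" by (cases x) simp
  obtain a b c where x: "x = (a, b, c)" by (cases x)
  show "\<exists>y\<in>carrier heisenberg_group. y \<otimes>\<^bsub>heisenberg_group\<^esub> x = \<one>\<^bsub>heisenberg_group\<^esub>"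
    by (rule bexI[of _ "(- a, - b, a * b - c)"]) (simp_all add: x)
qed auto

text \<open>The two products differ only in the corner entry, by the alternating form
  \<open>a * b' - a' * b\<close>.\<close>

lemma heisenberg_group_commute_iff:
  "x \<otimes>\<^bsub>heisenberg_group\<^esub> y = y \<otimes>\<^bsub>heisenberg_group\<^esub> x \<longleftrightarrow>
    fst x * fst (snd y) = fst y * fst (snd x)"
  by (cases x; cases y) (simp add: algebra_simps)

lemma UNIV_bit: "(UNIV :: bit set) = {0, 1}"
  using bit_not_zero_iff by blast

lemma finite_card_bit [simp]: "finite (UNIV :: bit set)" "card (UNIV :: bit set) = 2"
  by (simp_all add: UNIV_bit)

text \<open>Sums and products in \<open>bit\<close> are kept as field operations, so that ring laws
  apply to them.\<close>

declare add_bit_eq_xor [simp del] mult_bit_eq_and [simp del]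

lemma bit_add_self [simp]: "x + x = 0" for x :: bit
  by (cases x) auto

lemma finite_2_group_bit:
  "finite_2_group (additive_group :: bit monoid)"
  "finite_2_group (additive_group :: (bit \<times> bit) monoid)"
  "finite_2_group (heisenberg_group :: (bit \<times> bit \<times> bit) monoid)"
  unfolding finite_2_group_def Coset.order_def
  by (auto simp: group_additive_group group_heisenberg_group card_cartesian_product finite_prod
      simp flip: UNIV_Times_UNIV intro: exI[of _ 1] exI[of _ 2] exI[of _ 3])

section \<open>Recovering the graph\<close>

text \<open>Numbering \<open>V\<close> and \<open>W\<close>, which have equal size, turns
  \<open>A\<close> and \<open>B\<close> into square matrices with product 1, so
  \<open>det ?A\<close> is nonzero.\<close>

lemma ex_bij_betw_nonzero_entries:
  fixes A :: "'a \<Rightarrow> 'b \<Rightarrow> 'c::idom"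
  assumes V: "finite V" and W: "finite W" and card: "card V = card W"
    and inverse: "\<And>v u. v \<in> V \<Longrightarrow> u \<in> V \<Longrightarrow> (\<Sum>w\<in>W. A v w * B w u) = (if v = u then 1 else 0)"
  obtains \<sigma> where "bij_betw \<sigma> V W" "\<And>v. v \<in> V \<Longrightarrow> A v (\<sigma> v) \<noteq> 0"
proof -
  let ?n = "card V"
  obtain p where p: "bij_betw p {0..<?n} V" using ex_bij_betw_nat_finite[OF V] by blast
  obtain q where q: "bij_betw q {0..<?n} W" using ex_bij_betw_nat_finite[OF W] card by auto
  let ?A = "mat ?n ?n (\<lambda>(i, j). A (p i) (q j))" and ?B = "mat ?n ?n (\<lambda>(j, i). B (q j) (p i))"
  have pV: "p i \<in> V" if "i < ?n" for i using p that by (auto simp: bij_betw_def)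
  have "?A * ?B = 1\<^sub>m ?n"
  proof (rule eq_matI)
    fix i j assume "i < dim_row (1\<^sub>m ?n)" "j < dim_col (1\<^sub>m ?n)"
    then have ij: "i < ?n" "j < ?n" by simp_all
    have "(?A * ?B) $$ (i, j) = (\<Sum>k = 0..<?n. A (p i) (q k) * B (q k) (p j))"
      using ij by (simp add: scalar_prod_def)
    also have "\<dots> = (\<Sum>w\<in>W. A (p i) w * B w (p j))" by (rule sum.reindex_bij_betw[OF q])
    also have "\<dots> = (if p i = p j then 1 else 0)" by (rule inverse[OF pV[OF ij(1)] pV[OF ij(2)]])
    also have "\<dots> = 1\<^sub>m ?n $$ (i, j)"
      using ij p by (auto simp: bij_betw_def inj_on_def)
    finally show "(?A * ?B) $$ (i, j) = 1\<^sub>m ?n $$ (i, j)" .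
  qed simp_all
  then have "det ?A * det ?B = 1"
    using det_mult[of ?A ?n ?B] by simp
  then have "det ?A \<noteq> 0" by auto
  \<comment> \<open>Some summand of the Leibniz formula is nonzero, and then so is its product of
    entries, hence each single entry.\<close>
  then obtain \<pi> where \<pi>: "\<pi> permutes {0..<?n}" and "(\<Prod>i = 0..<?n. ?A $$ (i, \<pi> i)) \<noteq> 0"
    unfolding det_def'[OF mat_carrier] by (metis (no_types, lifting) mem_Collect_eq mult_zero_right sum.not_neutral_contains_not_neutral)
  then have nz: "?A $$ (i, \<pi> i) \<noteq> 0" if "i < ?n" for i using that by simp
  let ?p' = "the_inv_into {0..<?n} p"
  have p': "bij_betw ?p' V {0..<?n}" by (rule bij_betw_the_inv_into[OF p])
  show thesis
  proof
    show "bij_betw (q \<circ> \<pi> \<circ> ?p') V W"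
      using bij_betw_trans[OF p' bij_betw_trans[OF permutes_imp_bij[OF \<pi>] q]] by (simp add: o_assoc)
    fix v assume v: "v \<in> V"
    then have i: "?p' v < ?n" and "p (?p' v) = v"
      using p p' by (auto simp: bij_betw_def f_the_inv_into_f)
    moreover have "\<pi> (?p' v) < ?n" using permutes_in_image[OF \<pi>] i by auto
    ultimately show "A v ((q \<circ> \<pi> \<circ> ?p') v) \<noteq> 0" using nz[OF i] by simp
  qed
qed

section \<open>The pullback on vertex functions\<close>

text \<open>The same action of \<open>E\<close> as \<open>pro2_pullback\<close>, with homomorphisms
  recorded by their values on generators at both ends.\<close>

definition racg_pullback ::
  "'a pair_pre_digraph \<Rightarrow> 'b pair_pre_digraph \<Rightarrow> ('p, 'm) monoid_scheme \<Rightarrow>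
    (('a word set set \<Rightarrow> 'a word set set) \<Rightarrow> 'b word set set \<Rightarrow> 'b word set set) \<Rightarrow>
    ('b \<Rightarrow> 'p) \<Rightarrow> 'a \<Rightarrow> 'p" where
  "racg_pullback \<Gamma> \<Delta> P E f v =
    pro2_pullback (racg \<Gamma>) (racg \<Delta>) P E (presented_lift P f) (racg_gen \<Gamma> v)"

context
  fixes \<Gamma> :: "'a pair_pre_digraph" and \<Delta> :: "'b pair_pre_digraph"
    and E :: "('a word set set \<Rightarrow> 'a word set set) \<Rightarrow> 'b word set set \<Rightarrow> 'b word set set"
  assumes \<Gamma>: "pair_graph \<Gamma>" and \<Delta>: "pair_graph \<Delta>" and E: "pro2_hom (racg \<Gamma>) (racg \<Delta>) E"
begin

lemma racg_pullback_map:
  assumes P: "finite_2_group P" and f: "racg_map \<Delta> P f"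
  shows "racg_map \<Gamma> P (racg_pullback \<Gamma> \<Delta> P E f)"
proof -
  have gP: "Group.group P" by (rule finite_2_group_imp_group[OF P])
  show ?thesis
    unfolding racg_pullback_def
    by (rule racg_map_hom[OF \<Gamma> pro2_pullback_hom[OF group_racg group_racg P E racg_lift_hom[OF gP f]] gP])
qed

text \<open>The lift of \<open>k\<close> and the lift of \<open>f\<close> followed by
  \<open>a\<close> agree on generators, hence on the whole group, and \<open>pro2_pullback\<close>
  is natural.\<close>

lemma racg_pullback_natural:
  assumes P: "finite_2_group P" and Q: "finite_2_group Q" and f: "racg_map \<Delta> P f"
    and k: "racg_map \<Delta> Q k" and a: "a \<in> hom P Q"
    and eq: "\<And>w. w \<in> pverts \<Delta> \<Longrightarrow> k w = a (f w)" and v: "v \<in> pverts \<Gamma>"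
  shows "racg_pullback \<Gamma> \<Delta> Q E k v = a (racg_pullback \<Gamma> \<Delta> P E f v)"
proof -
  have gP: "Group.group P" and gQ: "Group.group Q"
    using finite_2_group_imp_group P Q by blast+
  let ?f = "presented_lift P f" and ?k = "presented_lift Q k"
  have f': "?f \<in> hom (racg \<Delta>) P" and k': "?k \<in> hom (racg \<Delta>) Q"
    using racg_lift_hom[OF gP f] racg_lift_hom[OF gQ k] .
  have af: "a \<circ> ?f \<in> hom (racg \<Delta>) Q" by (rule hom_compose[OF f' a])
  have "?k (racg_gen \<Delta> w) = (a \<circ> ?f) (racg_gen \<Delta> w)" if "w \<in> pverts \<Delta>" for w
    using that by (simp add: racg_lift_gen[OF gP f] racg_lift_gen[OF gQ k] eq)
  then have "?k x = (a \<circ> ?f) x" if "x \<in> carrier (racg \<Delta>)" for x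
    using racg_hom_unique[OF gQ k' af _ that] by blast
  then have "pro2_pullback (racg \<Gamma>) (racg \<Delta>) Q E ?k (racg_gen \<Gamma> v) =
      pro2_pullback (racg \<Gamma>) (racg \<Delta>) Q E (a \<circ> ?f) (racg_gen \<Gamma> v)"
    by (intro pro2_pullback_cong[OF group_racg group_racg Q E af _ racg_gen_closed[OF v]])
  also have "\<dots> = a (pro2_pullback (racg \<Gamma>) (racg \<Delta>) P E ?f (racg_gen \<Gamma> v))"
    by (rule pro2_pullback_natural[OF group_racg group_racg P E f' Q a racg_gen_closed[OF v]])
  finally show ?thesis by (simp add: racg_pullback_def)
qed

lemma racg_pullback_inverse:
  assumes P: "finite_2_group P" and f: "racg_map \<Delta> P f"
    and E': "pro2_hom (racg \<Delta>) (racg \<Gamma>) E'"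
    and inverse: "\<And>y. y \<in> carrier (pro2_completion (racg \<Delta>)) \<Longrightarrow> E (E' y) = y"
    and w: "w \<in> pverts \<Delta>"
  shows "racg_pullback \<Delta> \<Gamma> P E' (racg_pullback \<Gamma> \<Delta> P E f) w = f w"
proof -
  have gP: "Group.group P" by (rule finite_2_group_imp_group[OF P])
  let ?f = "presented_lift P f"
  let ?h = "pro2_pullback (racg \<Gamma>) (racg \<Delta>) P E ?f"
  let ?k = "presented_lift P (racg_pullback \<Gamma> \<Delta> P E f)"
  have f': "?f \<in> hom (racg \<Delta>) P" by (rule racg_lift_hom[OF gP f])
  have h: "?h \<in> hom (racg \<Gamma>) P" by (rule pro2_pullback_hom[OF group_racg group_racg P E f'])
  have map: "racg_map \<Gamma> P (racg_pullback \<Gamma> \<Delta> P E f)" by (rule racg_pullback_map[OF P f])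
  have k: "?k \<in> hom (racg \<Gamma>) P" by (rule racg_lift_hom[OF gP map])
  have "?k (racg_gen \<Gamma> v) = ?h (racg_gen \<Gamma> v)" if "v \<in> pverts \<Gamma>" for v
    using racg_lift_gen[OF gP map that] by (simp add: racg_pullback_def)
  then have "?k x = ?h x" if "x \<in> carrier (racg \<Gamma>)" for x
    using racg_hom_unique[OF gP k h _ that] by blast
  then have "pro2_pullback (racg \<Delta>) (racg \<Gamma>) P E' ?k (racg_gen \<Delta> w) =
      pro2_pullback (racg \<Delta>) (racg \<Gamma>) P E' ?h (racg_gen \<Delta> w)"
    by (intro pro2_pullback_cong[OF group_racg group_racg P E' h _ racg_gen_closed[OF w]])
  also have "\<dots> = ?f (racg_gen \<Delta> w)"
    by (rule pro2_pullback_inverse[OF group_racg group_racg P E f' E' inverse racg_gen_closed[OF w]])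
  finally show ?thesis using racg_lift_gen[OF gP f w] by (simp add: racg_pullback_def)
qed

end

section \<open>Linearity of the pullback and preservation of vanishing cup products\<close>

abbreviation bit_pullback ::
  "'a pair_pre_digraph \<Rightarrow> 'b pair_pre_digraph \<Rightarrow>
    (('a word set set \<Rightarrow> 'a word set set) \<Rightarrow> 'b word set set \<Rightarrow> 'b word set set) \<Rightarrow>
    ('b \<Rightarrow> bit) \<Rightarrow> 'a \<Rightarrow> bit" where
  "bit_pullback \<Gamma> \<Delta> E \<equiv> racg_pullback \<Gamma> \<Delta> (additive_group :: bit monoid) E"

text \<open>An abelian group of exponent 2 satisfies every Coxeter relation, so homomorphisms into
  it are arbitrary functions on the vertices.\<close>

lemma racg_map_additive:
  assumes "\<And>x :: 'p::ab_group_add. x + x = 0"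
  shows "racg_map \<Gamma> (additive_group :: 'p monoid) f"
  using assms by (intro racg_mapI) (auto simp: add.commute)

lemma racg_map_bit: "racg_map \<Gamma> (additive_group :: bit monoid) f"
  and racg_map_bit2: "racg_map \<Gamma> (additive_group :: (bit \<times> bit) monoid) f2"
  by (rule racg_map_additive; auto simp: zero_prod_def)+

text \<open>Disjoint supports without an arc between them, which for homomorphisms to the group of
  order 2 means that their cup product vanishes.\<close>

definition anticomplete :: "'a pair_pre_digraph \<Rightarrow> ('a \<Rightarrow> bit) \<Rightarrow> ('a \<Rightarrow> bit) \<Rightarrow> bool" where
  "anticomplete \<Gamma> f g \<longleftrightarrow> (\<forall>v\<in>pverts \<Gamma>. f v * g v = 0) \<and> (\<forall>(v, w)\<in>parcs \<Gamma>. f v * g w = f w * g v)"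

text \<open>The square of \<open>(a, b, c)\<close> is \<open>(0, 0, a * b)\<close> in characteristic
  2, and commuting is the vanishing of the alternating form; the third coordinate of
  \<open>h\<close> is arbitrary. For arcs between vertices the equation in
  \<open>anticomplete\<close> forces both products to be 0: if both were 1, then
  \<open>f v * g v = 1\<close>.\<close>

lemma racg_map_heisenberg_iff:
  "racg_map \<Gamma> (heisenberg_group :: (bit \<times> bit \<times> bit) monoid) h \<longleftrightarrow>
    anticomplete \<Gamma> (\<lambda>v. fst (h v)) (\<lambda>v. fst (snd (h v)))"
proof -
  have mult: "x \<otimes>\<^bsub>heisenberg_group\<^esub> y =
      (fst x + fst y, fst (snd x) + fst (snd y), snd (snd x) + snd (snd y) + fst x * fst (snd y))"
    for x y :: "bit \<times> bit \<times> bit"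
    by (cases x; cases y) simp
  have square: "x \<otimes>\<^bsub>heisenberg_group\<^esub> x = \<one>\<^bsub>heisenberg_group\<^esub> \<longleftrightarrow> fst x * fst (snd x) = 0"
    for x :: "bit \<times> bit \<times> bit"
    by (simp add: mult)
  show ?thesis unfolding racg_map_def anticomplete_def square heisenberg_group_commute_iff by simp
qed

context
  fixes \<Gamma> :: "'a pair_pre_digraph" and \<Delta> :: "'b pair_pre_digraph"
    and E :: "('a word set set \<Rightarrow> 'a word set set) \<Rightarrow> 'b word set set \<Rightarrow> 'b word set set"
  assumes \<Gamma>: "pair_graph \<Gamma>" and \<Delta>: "pair_graph \<Delta>" and E: "pro2_hom (racg \<Gamma>) (racg \<Delta>) E"
begin

lemma bit_pullback_cong:
  assumes "\<And>w. w \<in> pverts \<Delta> \<Longrightarrow> k w = f w" and v: "v \<in> pverts \<Gamma>"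
  shows "bit_pullback \<Gamma> \<Delta> E k v = bit_pullback \<Gamma> \<Delta> E f v"
  using racg_pullback_natural[OF \<Gamma> \<Delta> E finite_2_group_bit(1,1) racg_map_bit racg_map_bit, of "\<lambda>x. x" k f v]
  assms by (simp add: hom_def)

text \<open>The pair of \<open>f\<close> and \<open>g\<close> is a map to the group of order 4. Its
  pullback \<open>?p\<close> determines those of \<open>f\<close>, \<open>g\<close> and their sum,
  by naturality along the projections and the addition.\<close>

lemma bit_pullback_add:
  assumes v: "v \<in> pverts \<Gamma>"
  shows "bit_pullback \<Gamma> \<Delta> E (\<lambda>w. f w + g w) v = bit_pullback \<Gamma> \<Delta> E f v + bit_pullback \<Gamma> \<Delta> E g v"
proof -
  let ?p = "racg_pullback \<Gamma> \<Delta> additive_group E (\<lambda>w. (f w, g w)) v"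
  have nat: "bit_pullback \<Gamma> \<Delta> E (\<lambda>w. a (f w, g w)) v = a ?p"
    if "a \<in> hom additive_group additive_group" for a
    by (rule racg_pullback_natural[OF \<Gamma> \<Delta> E finite_2_group_bit(2,1) racg_map_bit2 racg_map_bit that _ v])
      (rule HOL.refl)
  show ?thesis
    using nat[OF additive_group_hom(1)] nat[OF additive_group_hom(2)] nat[OF additive_group_hom(3)]
    by (simp only: fst_conv snd_conv)
qed

text \<open>Every scalar is 0 or 1, so additivity already gives linearity.\<close>

lemma bit_pullback_sum:
  assumes v: "v \<in> pverts \<Gamma>" and "finite W"
  shows "bit_pullback \<Gamma> \<Delta> E (\<lambda>u. \<Sum>w\<in>W. c w * e w u) v = (\<Sum>w\<in>W. c w * bit_pullback \<Gamma> \<Delta> E (e w) v)"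
proof -
  have zero: "bit_pullback \<Gamma> \<Delta> E (\<lambda>u. 0) v = 0"
    using bit_pullback_add[OF v, of "\<lambda>u. 0" "\<lambda>u. 0"] by simp
  have scale: "bit_pullback \<Gamma> \<Delta> E (\<lambda>u. b * f u) v = b * bit_pullback \<Gamma> \<Delta> E f v" for b f
    using zero by (cases b) simp_all
  show ?thesis
    using \<open>finite W\<close> by induction (simp_all add: zero scale bit_pullback_add[OF v])
qed

text \<open>The lift \<open>(f, g, 0)\<close> pulls back to a map into the Heisenberg group.
  Naturality identifies its first two coordinates with the pullbacks of \<open>f\<close> and
  \<open>g\<close>; the criterion \<open>racg_map_heisenberg_iff\<close> puts no condition on the
  third.\<close>

lemma bit_pullback_anticomplete:
  assumes "anticomplete \<Delta> f g"
  shows "anticomplete \<Gamma> (bit_pullback \<Gamma> \<Delta> E f) (bit_pullback \<Gamma> \<Delta> E g)"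
proof -
  interpret pair_graph \<Gamma> by (rule \<Gamma>)
  let ?P = "heisenberg_group :: (bit \<times> bit \<times> bit) monoid"
  let ?h = "\<lambda>w. (f w, g w, 0)"
  let ?p = "racg_pullback \<Gamma> \<Delta> ?P E ?h"
  have h: "racg_map \<Delta> ?P ?h" using assms by (simp add: racg_map_heisenberg_iff)
  have nat: "bit_pullback \<Gamma> \<Delta> E (\<lambda>w. a (?h w)) v = a (?p v)"
    if "a \<in> hom ?P additive_group" "v \<in> pverts \<Gamma>" for a v
    by (rule racg_pullback_natural[OF \<Gamma> \<Delta> E finite_2_group_bit(3,1) h racg_map_bit that(1) _ that(2)])
      (rule HOL.refl)
  have "fst \<in> hom ?P additive_group" "(\<lambda>x. fst (snd x)) \<in> hom ?P additive_group"
    by (auto simp: hom_def)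
  from nat[OF this(1)] nat[OF this(2)]
  have p: "bit_pullback \<Gamma> \<Delta> E f v = fst (?p v)" "bit_pullback \<Gamma> \<Delta> E g v = fst (snd (?p v))"
    if "v \<in> pverts \<Gamma>" for v
    using that by simp_all
  have "anticomplete \<Gamma> (\<lambda>v. fst (?p v)) (\<lambda>v. fst (snd (?p v)))"
    using racg_pullback_map[OF \<Gamma> \<Delta> E finite_2_group_bit(3) h] by (simp add: racg_map_heisenberg_iff)
  moreover have "v \<in> pverts \<Gamma>" "w \<in> pverts \<Gamma>" if "(v, w) \<in> parcs \<Gamma>" for v w
    using that arc_fst_in_verts arc_snd_in_verts by force+
  ultimately show ?thesis by (auto simp: anticomplete_def p)
qed

end

section \<open>Vertex bijections preserving nonadjacency\<close>

text \<open>The pullback of bit-valued vertex functions has a left inverse, so it is injective, and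
  the numbers of such functions are powers of 2 with the numbers of vertices as exponents.\<close>

lemma card_verts_le:
  assumes \<Gamma>: "pair_graph \<Gamma>" and \<Delta>: "pair_graph \<Delta>"
    and E: "pro2_hom (racg \<Gamma>) (racg \<Delta>) E" and E': "pro2_hom (racg \<Delta>) (racg \<Gamma>) E'"
    and inverse: "\<And>y. y \<in> carrier (pro2_completion (racg \<Delta>)) \<Longrightarrow> E (E' y) = y"
  shows "card (pverts \<Delta>) \<le> card (pverts \<Gamma>)"
proof -
  interpret \<Gamma>: pair_graph \<Gamma> by (rule \<Gamma>)
  interpret \<Delta>: pair_graph \<Delta> by (rule \<Delta>)
  \<comment> \<open>Extensional functions form a finite set on which agreement at the vertices is
    equality.\<close>
  let ?A = "pverts \<Delta> \<rightarrow>\<^sub>E (UNIV :: bit set)" and ?B = "pverts \<Gamma> \<rightarrow>\<^sub>E (UNIV :: bit set)"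
  let ?T = "\<lambda>f. restrict (bit_pullback \<Gamma> \<Delta> E f) (pverts \<Gamma>)"
  have "inj_on ?T ?A"
  proof (rule inj_onI)
    fix f g assume fg: "f \<in> ?A" "g \<in> ?A" "?T f = ?T g"
    have "f w = g w" if w: "w \<in> pverts \<Delta>" for w
    proof -
      have "bit_pullback \<Gamma> \<Delta> E f v = bit_pullback \<Gamma> \<Delta> E g v" if "v \<in> pverts \<Gamma>" for v
        using fun_cong[OF fg(3), of v] that by simp
      then have "bit_pullback \<Delta> \<Gamma> E' (bit_pullback \<Gamma> \<Delta> E f) w =
          bit_pullback \<Delta> \<Gamma> E' (bit_pullback \<Gamma> \<Delta> E g) w"
        by (intro bit_pullback_cong[OF \<Delta> \<Gamma> E' _ w])
      then show ?thesis
        using racg_pullback_inverse[OF \<Gamma> \<Delta> E finite_2_group_bit(1) racg_map_bit E' inverse w] by simp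
    qed
    then show "f = g" using fg(1,2) by (intro PiE_ext)
  qed
  then have "card ?A \<le> card ?B"
    using \<Gamma>.pair_finite_verts by (intro card_inj_on_le) (auto intro!: finite_PiE)
  then have "(2::nat) ^ card (pverts \<Delta>) \<le> 2 ^ card (pverts \<Gamma>)"
    using \<Gamma>.pair_finite_verts \<Delta>.pair_finite_verts by (simp add: card_PiE)
  then show ?thesis by simp
qed

lemma ex_bij_preserving_nonarcs:
  assumes \<Gamma>: "pair_graph \<Gamma>" and \<Delta>: "pair_graph \<Delta>"
    and E: "pro2_hom (racg \<Gamma>) (racg \<Delta>) E" and E': "pro2_hom (racg \<Delta>) (racg \<Gamma>) E'"
    and inverse: "\<And>x. x \<in> carrier (pro2_completion (racg \<Gamma>)) \<Longrightarrow> E' (E x) = x"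
      "\<And>y. y \<in> carrier (pro2_completion (racg \<Delta>)) \<Longrightarrow> E (E' y) = y"
  obtains \<sigma> where "bij_betw \<sigma> (pverts \<Delta>) (pverts \<Gamma>)"
    "\<And>v w. v \<in> pverts \<Delta> \<Longrightarrow> w \<in> pverts \<Delta> \<Longrightarrow> v \<noteq> w \<Longrightarrow> (v, w) \<notin> parcs \<Delta> \<Longrightarrow> (\<sigma> v, \<sigma> w) \<notin> parcs \<Gamma>"
proof -
  interpret \<Gamma>: pair_graph \<Gamma> by (rule \<Gamma>)
  interpret \<Delta>: pair_graph \<Delta> by (rule \<Delta>)
  have fin: "finite (pverts \<Delta>)" "finite (pverts \<Gamma>)"
    by (rule \<Delta>.pair_finite_verts \<Gamma>.pair_finite_verts)+
  have card: "card (pverts \<Delta>) = card (pverts \<Gamma>)"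
    using card_verts_le[OF \<Gamma> \<Delta> E E' inverse(2)] card_verts_le[OF \<Delta> \<Gamma> E' E inverse(1)] by simp
  \<comment> \<open>\<open>?e v\<close> is the indicator of \<open>v\<close>; thus \<open>?A\<close>
    and \<open>?B\<close> are the matrices of the two pullbacks with respect to the indicator
    bases.\<close>
  let ?e = "\<lambda>v w. of_bool (w = v) :: bit"
  let ?A = "\<lambda>v. bit_pullback \<Gamma> \<Delta> E (?e v)" and ?B = "\<lambda>x. bit_pullback \<Delta> \<Gamma> E' (?e x)"
  have matrix: "(\<Sum>x\<in>pverts \<Gamma>. ?A v x * ?B x u) = (if v = u then 1 else 0)"
    if u: "u \<in> pverts \<Delta>" for v u
  proof -
    \<comment> \<open>On the vertices, \<open>?A v\<close> is the sum of the indicators weighted by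
      its values. Linearity therefore turns the matrix entry into the double pullback of
      \<open>?e v\<close>, evaluated at \<open>u\<close>.\<close>
    have "(\<Sum>x\<in>pverts \<Gamma>. ?A v x * ?B x u) =
        bit_pullback \<Delta> \<Gamma> E' (\<lambda>y. \<Sum>x\<in>pverts \<Gamma>. ?A v x * ?e x y) u"
      by (rule bit_pullback_sum[OF \<Delta> \<Gamma> E' u fin(2), symmetric])
    also have "\<dots> = bit_pullback \<Delta> \<Gamma> E' (?A v) u"
      using fin(2) by (intro bit_pullback_cong[OF \<Delta> \<Gamma> E' _ u]) simp
    also have "\<dots> = ?e v u"
      by (rule racg_pullback_inverse[OF \<Gamma> \<Delta> E finite_2_group_bit(1) racg_map_bit E' inverse(2) u])
    finally show ?thesis by simp
  qed
  obtain \<sigma> where \<sigma>: "bij_betw \<sigma> (pverts \<Delta>) (pverts \<Gamma>)"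
    and one: "\<And>v. v \<in> pverts \<Delta> \<Longrightarrow> ?A v (\<sigma> v) \<noteq> 0"
    using ex_bij_betw_nonzero_entries[OF fin card, of ?A ?B] matrix by blast
  show thesis
  proof (rule that[OF \<sigma>])
    fix v w assume v: "v \<in> pverts \<Delta>" and w: "w \<in> pverts \<Delta>" and "v \<noteq> w" "(v, w) \<notin> parcs \<Delta>"
    moreover have "(w, v) \<notin> parcs \<Delta>" using \<open>(v, w) \<notin> parcs \<Delta>\<close> \<Delta>.pair_sym_arcs
      by (auto simp: symmetric_def sym_def)
    ultimately have "anticomplete \<Delta> (?e v) (?e w)" by (auto simp: anticomplete_def)
    from bit_pullback_anticomplete[OF \<Gamma> \<Delta> E this] have orth: "anticomplete \<Gamma> (?A v) (?A w)" .
    have in_\<Gamma>: "\<sigma> v \<in> pverts \<Gamma>" "\<sigma> w \<in> pverts \<Gamma>" using \<sigma> v w by (auto simp: bij_betw_def)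
    \<comment> \<open>Disjointness of supports at \<open>\<sigma> v\<close> gives
      \<open>?A w (\<sigma> v) = 0\<close>; an arc from \<open>\<sigma> v\<close> to
      \<open>\<sigma> w\<close> would then equate a product of ones with 0.\<close>
    have "?A v (\<sigma> v) = 1" "?A w (\<sigma> w) = 1" using one[OF v] one[OF w] by simp_all
    moreover have "?A v (\<sigma> v) * ?A w (\<sigma> v) = 0"
      using orth in_\<Gamma> unfolding anticomplete_def by blast
    moreover have "?A v (\<sigma> v) * ?A w (\<sigma> w) = ?A v (\<sigma> w) * ?A w (\<sigma> v)" if "(\<sigma> v, \<sigma> w) \<in> parcs \<Gamma>"
      using orth that unfolding anticomplete_def by auto
    ultimately show "(\<sigma> v, \<sigma> w) \<notin> parcs \<Gamma>" by auto
  qed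
qed

section \<open>Counting nonadjacent pairs and assembling the graph isomorphism\<close>

definition nonarcs :: "'a pair_pre_digraph \<Rightarrow> ('a \<times> 'a) set" where
  "nonarcs \<Gamma> = {(v, w). v \<in> pverts \<Gamma> \<and> w \<in> pverts \<Gamma> \<and> v \<noteq> w \<and> (v, w) \<notin> parcs \<Gamma>}"

lemma finite_nonarcs:
  assumes "pair_graph \<Gamma>"
  shows "finite (nonarcs \<Gamma>)"
proof -
  interpret pair_graph \<Gamma> by fact
  show ?thesis
    by (rule finite_subset[of _ "pverts \<Gamma> \<times> pverts \<Gamma>"]) (auto simp: nonarcs_def pair_finite_verts)
qed

lemma inj_on_map_prod_nonarcs:
  "inj_on \<sigma> (pverts \<Gamma>) \<Longrightarrow> inj_on (map_prod \<sigma> \<sigma>) (nonarcs \<Gamma>)"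
  by (auto simp: inj_on_def nonarcs_def)

lemma map_prod_nonarcs_subset:
  assumes "bij_betw \<sigma> (pverts \<Gamma>) (pverts \<Delta>)"
    and "\<And>v w. v \<in> pverts \<Gamma> \<Longrightarrow> w \<in> pverts \<Gamma> \<Longrightarrow> v \<noteq> w \<Longrightarrow> (v, w) \<notin> parcs \<Gamma> \<Longrightarrow> (\<sigma> v, \<sigma> w) \<notin> parcs \<Delta>"
  shows "map_prod \<sigma> \<sigma> ` nonarcs \<Gamma> \<subseteq> nonarcs \<Delta>"
  using assms by (auto simp: nonarcs_def bij_betw_def inj_on_def)

text \<open>Without loops, the arcs are exactly the pairs of distinct vertices outside
  \<open>nonarcs\<close>, so a vertex bijection that matches the nonadjacent pairs matches the
  arcs.\<close>

lemma digraph_iso_of_nonarcs: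
  assumes \<Gamma>: "pair_graph \<Gamma>" and \<Delta>: "pair_graph \<Delta>" and \<sigma>: "bij_betw \<sigma> (pverts \<Gamma>) (pverts \<Delta>)"
    and img: "map_prod \<sigma> \<sigma> ` nonarcs \<Gamma> = nonarcs \<Delta>"
  shows "digraph_iso (with_proj \<Gamma>) (with_proj \<Delta>)"
proof -
  interpret \<Gamma>: pair_graph \<Gamma> by (rule \<Gamma>)
  interpret \<Delta>: pair_graph \<Delta> by (rule \<Delta>)
  have inj: "inj_on \<sigma> (pverts \<Gamma>)" and verts: "\<sigma> ` pverts \<Gamma> = pverts \<Delta>"
    using \<sigma> by (auto simp: bij_betw_def)
  have ends: "v \<in> pverts \<Gamma>" "w \<in> pverts \<Gamma>" "v \<noteq> w" if "(v, w) \<in> parcs \<Gamma>" for v w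
    using that \<Gamma>.arc_fst_in_verts \<Gamma>.arc_snd_in_verts \<Gamma>.pair_no_loops by force+
  have ends': "v \<in> pverts \<Delta>" "w \<in> pverts \<Delta>" "v \<noteq> w" if "(v, w) \<in> parcs \<Delta>" for v w
    using that \<Delta>.arc_fst_in_verts \<Delta>.arc_snd_in_verts \<Delta>.pair_no_loops by force+
  have nonarc: "(v, w) \<in> nonarcs \<Gamma> \<longleftrightarrow> (\<sigma> v, \<sigma> w) \<in> nonarcs \<Delta>"
    if "v \<in> pverts \<Gamma>" "w \<in> pverts \<Gamma>" for v w
  proof
    assume "(\<sigma> v, \<sigma> w) \<in> nonarcs \<Delta>"
    then obtain a b where ab: "(a, b) \<in> nonarcs \<Gamma>" "\<sigma> v = \<sigma> a" "\<sigma> w = \<sigma> b" using img by force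
    then have "a \<in> pverts \<Gamma>" "b \<in> pverts \<Gamma>" by (auto simp: nonarcs_def)
    then have "v = a" "w = b" using inj_onD[OF inj ab(2)] inj_onD[OF inj ab(3)] that by auto
    then show "(v, w) \<in> nonarcs \<Gamma>" using ab(1) by simp
  qed (use img in force)
  have arc: "(v, w) \<in> parcs \<Gamma> \<longleftrightarrow> (\<sigma> v, \<sigma> w) \<in> parcs \<Delta>" if vw: "v \<in> pverts \<Gamma>" "w \<in> pverts \<Gamma>" for v w
  proof (cases "v = w")
    case True
    then show ?thesis using ends(3)[of v w] ends'(3)[of "\<sigma> v" "\<sigma> w"] by auto
  next
    case False
    then have "\<sigma> v \<noteq> \<sigma> w" using inj vw by (auto dest: inj_onD)
    then show ?thesis using nonarc[OF vw] vw verts False by (auto simp: nonarcs_def)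
  qed
  have arcs: "map_prod \<sigma> \<sigma> ` parcs \<Gamma> = parcs \<Delta>"
  proof
    have "(\<sigma> v, \<sigma> w) \<in> parcs \<Delta>" if "(v, w) \<in> parcs \<Gamma>" for v w
      using arc[OF ends(1,2)[OF that]] that by simp
    then show "map_prod \<sigma> \<sigma> ` parcs \<Gamma> \<subseteq> parcs \<Delta>" by auto
    show "parcs \<Delta> \<subseteq> map_prod \<sigma> \<sigma> ` parcs \<Gamma>"
    proof (rule subsetI, clarify)
      fix x y assume xy: "(x, y) \<in> parcs \<Delta>"
      then obtain v w where vw: "v \<in> pverts \<Gamma>" "w \<in> pverts \<Gamma>" "x = \<sigma> v" "y = \<sigma> w"
        using ends'(1,2)[OF xy] verts by blast
      then have "(v, w) \<in> parcs \<Gamma>" using arc[OF vw(1,2)] xy by simp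
      then show "(x, y) \<in> map_prod \<sigma> \<sigma> ` parcs \<Gamma>" using vw by force
    qed
  qed
  let ?i = "\<lparr>iso_verts = \<sigma>, iso_arcs = map_prod \<sigma> \<sigma>, iso_head = snd, iso_tail = fst\<rparr>"
  have "inj_on (map_prod \<sigma> \<sigma>) (parcs \<Gamma>)"
    by (rule inj_on_subset[OF map_prod_inj_on[OF inj inj]]) (use ends in auto)
  then have "pre_digraph.digraph_isomorphism (with_proj \<Gamma>) ?i"
    using inj \<Gamma>.wf_digraph_axioms by (simp add: pre_digraph.digraph_isomorphism_def wf_digraph_wp_iff \<Gamma>.pair_wf_digraph_axioms)
  moreover have "with_proj \<Delta> = app_iso ?i (with_proj \<Gamma>)"
    by (simp add: app_iso_def arcs verts with_proj_def)
  ultimately show ?thesis unfolding digraph_iso_def by blast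
qed

theorem theorem6:
  fixes \<Gamma> :: "'a pair_pre_digraph" and \<Gamma>' :: "'b pair_pre_digraph"
  assumes "pair_graph \<Gamma>" and "pair_graph \<Gamma>'"
  shows "topological_group_isomorphic
           (pro2_completion (racg \<Gamma>)) (pro2_topology (racg \<Gamma>))
           (pro2_completion (racg \<Gamma>')) (pro2_topology (racg \<Gamma>'))
         \<longleftrightarrow> digraph_iso (with_proj \<Gamma>) (with_proj \<Gamma>')"
proof
  assume "topological_group_isomorphic
           (pro2_completion (racg \<Gamma>)) (pro2_topology (racg \<Gamma>))
           (pro2_completion (racg \<Gamma>')) (pro2_topology (racg \<Gamma>'))"
  then obtain E E' where E: "pro2_hom (racg \<Gamma>) (racg \<Gamma>') E" and E': "pro2_hom (racg \<Gamma>') (racg \<Gamma>) E'"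
    and inv: "\<And>x. x \<in> carrier (pro2_completion (racg \<Gamma>)) \<Longrightarrow> E' (E x) = x"
      "\<And>y. y \<in> carrier (pro2_completion (racg \<Gamma>')) \<Longrightarrow> E (E' y) = y"
    by (rule topological_group_isomorphic_pro2E[OF group_racg group_racg]) blast
  \<comment> \<open>Pullback is contravariant: the bijection obtained from \<open>E\<close> runs
    from \<open>\<Gamma>'\<close> to \<open>\<Gamma>\<close>. The roles are therefore exchanged for
    \<open>\<sigma>\<close>.\<close>
  obtain \<sigma> where \<sigma>: "bij_betw \<sigma> (pverts \<Gamma>) (pverts \<Gamma>')"
    and sub: "map_prod \<sigma> \<sigma> ` nonarcs \<Gamma> \<subseteq> nonarcs \<Gamma>'"
    using ex_bij_preserving_nonarcs[OF assms(2,1) E' E inv(2,1)] map_prod_nonarcs_subset by metis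
  obtain \<tau> where \<tau>: "bij_betw \<tau> (pverts \<Gamma>') (pverts \<Gamma>)"
    and sub': "map_prod \<tau> \<tau> ` nonarcs \<Gamma>' \<subseteq> nonarcs \<Gamma>"
    using ex_bij_preserving_nonarcs[OF assms E E' inv] map_prod_nonarcs_subset by metis
  note fin = finite_nonarcs[OF assms(1)] finite_nonarcs[OF assms(2)]
  have inj: "inj_on (map_prod \<sigma> \<sigma>) (nonarcs \<Gamma>)" and "inj_on (map_prod \<tau> \<tau>) (nonarcs \<Gamma>')"
    using \<sigma> \<tau> by (auto simp: bij_betw_def intro: inj_on_map_prod_nonarcs)
  \<comment> \<open>Through \<open>\<tau>\<close> there are at most as many nonadjacent pairs in
    \<open>\<Gamma>'\<close> as in \<open>\<Gamma>\<close>, so the inclusion \<open>sub\<close> of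
    finite sets is an equality.\<close>
  then have "card (nonarcs \<Gamma>') \<le> card (map_prod \<sigma> \<sigma> ` nonarcs \<Gamma>)"
    using card_inj_on_le[OF _ sub' fin(1)] by (simp add: card_image)
  then have "map_prod \<sigma> \<sigma> ` nonarcs \<Gamma> = nonarcs \<Gamma>'"
    by (rule card_seteq[OF fin(2) sub])
  then show "digraph_iso (with_proj \<Gamma>) (with_proj \<Gamma>')"
    by (rule digraph_iso_of_nonarcs[OF assms \<sigma>])
next
  assume "digraph_iso (with_proj \<Gamma>) (with_proj \<Gamma>')"
  then show "topological_group_isomorphic
           (pro2_completion (racg \<Gamma>)) (pro2_topology (racg \<Gamma>))
           (pro2_completion (racg \<Gamma>')) (pro2_topology (racg \<Gamma>'))"
    by (rule digraph_iso_imp_pro2_isomorphic[OF assms])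
qed

end
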